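(* Let $\mathcal{S}=\{S_l\}_{l\in\mathcal{I}}$ be a cell decomposition of $D$, $\delta t>0$ a time step and $W\subset\mathbb{R}^n$ nonempty. Let $\mathbf{l}=(l_1,\ldots,l_N)\in\mathcal{I}^N$ be an initial cell configuration and consider any feedback laws $$v_i=k_{i,\mathrm{pr}_i(\mathbf{l})}(t,x_i,\mathbf{x}_j;x_{i0},w_i),\quad i\in\mathcal{N},\qquad(\ast)$$ assigned to the agents, that satisfy (P1) and (P2). Then: (i) For each $w_i\in W$, $i\in\mathcal{N}$, and each initial condition $x(0)\in D^N$ with $x_i(0)=x_{i0}\in S_{l_i}$, $i\in\mathcal{N}$, the solution $x(\cdot)$ of the closed-loop system $\dot x_i=f_i(x_i,\mathbf{x}_j)+v_i$ with $v_i$ given by $(\ast)$ is defined and remains in $D^N$ for all $t\in[0,\tilde T)$, where $\tilde T:=\min\{\delta t,\min\{T(x_{i0},w_i):i\in\mathcal{N}\}\}$, and $\lim_{t\to\tilde T^-}x(t)\in D^N$. Assume additionally that (P3) also holds for all these feedback laws, i.e. that (P) is satisfied. Then: (iia) The solution $x(t)$ above remains in $D^N$ for all $t\in[0,\delta t]$ and satisfies $$|k_{i,\mathrm{pr}_i(\mathbf{l})}(t,x_i(t),\mathbf{x}_j(t);x_{i0},w_i)|\le v_{\max},\quad\forall t\in[0,\delta t],\ i\in\mathcal{N}.$$ (iib) There exists a piecewise continuous function $v=(v_1,\ldots,v_N):[0,\infty)\to\mathbb{R}^{Nn}$ with $|v_i(t)|\le v_{\max}$ for all $t\ge0$, $i\in\mathcal{N}$,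 such that the solution $x(\cdot)$ above and the solution $\xi(\cdot)$ of $\dot\xi_i=f_i(\xi_i,\boldsymbol{\xi}_j)+v_i(t)$, $i\in\mathcal{N}$, with the same initial condition as $x(\cdot)$, coincide on $[0,\delta t]$.
   Context: Notation: $|\cdot|$ is the Euclidean norm; $B(R)$ is the closed ball of radius $R$ centered at $0$ in $\mathbb{R}^n$; $A+B$ is the Minkowski sum. System. $\mathcal{N}=\{1,\ldots,N\}$ is the set of agents; each agent $i$ has a set of neighbors $\mathcal{N}_i\subset\mathcal{N}\setminus\{i\}$ of cardinality $N_i$, ordered as $j_1,\ldots,j_{N_i}$ (depending on $i$), and $\mathbf{x}_j=\mathbf{x}_{j(i)}:=(x_{j_1},\ldots,x_{j_{N_i}})$. $D\subset\mathbb{R}^n$ is a domain (nonempty, open, connected). The multi-agent system is $\dot x_i=f_i(x_i,\mathbf{x}_j)+v_i$, $x_i\in D$, $i\in\mathcal{N}$, where each $f_i:D^{N_i+1}\to\mathbb{R}^n$ is locally Lipschitz and $|f_i|\le M$ on $D^{N_i+1}$; free inputs $v_i$ are piecewise continuous with $|v_i(t)|\le v_{\max}$ for all $t\ge0$; $0<v_{\max}<M$. Invariance Assumption: for every $x(0)\in D^N$ and every piecewise continuous $v=(v_1,\ldots,v_N):[0,\infty)\to\mathbb{R}^{Nn}$ with $|v_i(t)|\le v_{\max}$ for all $t\ge 0$, $i\in\mathcal{N}$, the unique solution of the system is defined and remains in $D^N$ for all $t\ge0$. Cell decomposition. A cell decomposition of $D$ is a finite or countable family $\{S_l\}_{l\in\mathcal{I}}$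 of nonempty connected subsets of $D$ with $\sup_l\mathrm{diam}(S_l)<\infty$, $\mathrm{cl}(\mathrm{int}(S_l))=S_l$ (closure relative to $D$), $\mathrm{int}(S_l)\cap\mathrm{int}(S_{\hat l})=\emptyset$ for $l\ne\hat l$, and $\bigcup_l S_l=D$. For $\mathbf{l}=(l_1,\ldots,l_N)\in\mathcal{I}^N$ (a cell configuration) put $\mathrm{pr}_i(\mathbf{l}):=(l_i,l_{j_1},\ldots,l_{j_{N_i}})\in\mathcal{I}^{N_i+1}$ (a cell configuration $\mathbf{l}_i$ of agent $i$). Property (P). Let $R_{\max}:=\delta t(M+v_{\max})$. A feedback law for agent $i$ and cell configuration $\mathbf{l}_i=(l_i,l_{j_1},\ldots,l_{j_{N_i}})$ is a family of times $T(x_{i0},w_i)>0$ (possibly $+\infty$, and depending on the agent's law) and maps $k_{i,\mathbf{l}_i}(\cdot;x_{i0},w_i):[0,T(x_{i0},w_i))\times D^{N_i+1}\to\mathbb{R}^n$, parameterized by $x_{i0}\in S_{l_i}$, $w_i\in W$. It satisfies Property (P) if: (P1) each $k_{i,\mathbf{l}_i}(\cdot;x_{i0},w_i)$ is locally Lipschitz continuous; (P2) $|k_{i,\mathbf{l}_i}(t,x_i,\mathbf{x}_j;x_{i0},w_i)|\le v_{\max}$ for all $t\in[0,\delta t]\cap[0,T(x_{i0},w_i))$, $x_i\in(S_{l_i}+B(R_{\max}))\cap D$, $x_{j_m}\in(S_{l_{j_m}}+B(R_{\max}))\cap D$ ($m=1,\ldots,N_i$), $x_{i0}\in S_{l_i}$,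 $w_i\in W$; (P3) $T(x_{i0},w_i)>\delta t$ for all $x_{i0}\in S_{l_i}$, $w_i\in W$.
   Formalization: "Piecewise continuous" is read, in the Invariance Assumption and in (iib), as finitely many discontinuities on each bounded interval without requiring one-sided limits; if one-sided limits were required of the inputs in the Invariance Assumption, (i) could fail. *)

theory Defs
  imports "HOL-Analysis.Analysis" "HOL-Library.Set_Algebras" "HOL-Library.Extended_Real"
begin

text \<open>Agents are the elements of a finite type; \<open>nb i\<close> is the ordered list of neighbors of agent
  \<open>i\<close>. The agent-plus-neighbors tuple \<open>(z\<^sub>i, z\<^sub>j\<^sub>1, ..., z\<^sub>j\<^sub>N)\<close> is a list of length
  \<open>N\<^sub>i + 1\<close> with the entry of the agent itself in front. The same projection serves for states
  \<open>(x\<^sub>i, x\<^sub>j)\<close> and for cell configurations.\<close>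

definition pr :: "('a \<Rightarrow> 'a list) \<Rightarrow> 'a \<Rightarrow> ('a \<Rightarrow> 'b) \<Rightarrow> 'b list" where
  "pr nb i z = map z (i # nb i)"

definition tuples :: "'b set \<Rightarrow> nat \<Rightarrow> 'b list set" where
  "tuples D m = {X \<in> lists D. length X = m}"

definition configs :: "(real ^ 'n) set \<Rightarrow> (real ^ 'n ^ 'a::finite) set" where
  "configs D = {x. \<forall>i. x $ i \<in> D}"

text \<open>Lists carry no metric in the library: these are the Euclidean distances on
  \<open>(\<real>\<^sup>n)\<^sup>m\<close> and on \<open>\<real> \<times> (\<real>\<^sup>n)\<^sup>m\<close>, to be used for tuples of equal length only.\<close>

definition tuple_dist :: "'b::metric_space list \<Rightarrow> 'b list \<Rightarrow> real" where
  "tuple_dist X Y = L2_set (\<lambda>m. dist (X ! m) (Y ! m)) {..<length X}"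

definition time_tuple_dist ::
    "real \<times> 'b::metric_space list \<Rightarrow> real \<times> 'b list \<Rightarrow> real" where
  "time_tuple_dist p q = sqrt ((dist (fst p) (fst q))\<^sup>2 + (tuple_dist (snd p) (snd q))\<^sup>2)"

definition locally_lipschitz_wrt ::
    "('p \<Rightarrow> 'p \<Rightarrow> real) \<Rightarrow> 'p set \<Rightarrow> ('p \<Rightarrow> 'b::metric_space) \<Rightarrow> bool" where
  "locally_lipschitz_wrt d A g \<longleftrightarrow>
     (\<forall>p\<in>A. \<exists>r>0. \<exists>L\<ge>0. \<forall>q\<in>A. \<forall>q'\<in>A.
        d p q < r \<longrightarrow> d p q' < r \<longrightarrow> dist (g q) (g q') \<le> L * d q q')"

text \<open>Cell decompositions. Boundedness is explicit because \<open>diameter\<close> is unspecified on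
  unbounded sets; since \<open>D\<close> is open, interiors relative to \<open>D\<close> are the usual interiors.\<close>

definition cell_decomposition ::
    "(real ^ 'n) set \<Rightarrow> 'c set \<Rightarrow> ('c \<Rightarrow> (real ^ 'n) set) \<Rightarrow> bool" where
  "cell_decomposition D I S \<longleftrightarrow>
     countable I \<and>
     (\<forall>l\<in>I. S l \<noteq> {} \<and> connected (S l) \<and> S l \<subseteq> D) \<and>
     (\<forall>l\<in>I. bounded (S l)) \<and> bdd_above ((\<lambda>l. diameter (S l)) ` I) \<and>
     (\<forall>l\<in>I. closure (interior (S l)) \<inter> D = S l) \<and>
     (\<forall>l\<in>I. \<forall>l'\<in>I. l \<noteq> l' \<longrightarrow> interior (S l) \<inter> interior (S l') = {}) \<and>
     (\<Union>l\<in>I. S l) = D"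

text \<open>Piecewise continuity on \<open>[0, \<infinity>)\<close>: finitely many discontinuities in every bounded time
  interval. One-sided limits at the discontinuities are not demanded; all inputs considered are
  bounded. (A bounded closed-loop control on \<open>[0, T)\<close> need not have a limit at \<open>T\<close>.)\<close>

definition discontinuities :: "(real \<Rightarrow> 'b::topological_space) \<Rightarrow> real set" where
  "discontinuities v = {t. 0 \<le> t \<and> \<not> continuous (at t within {0..}) v}"

definition piecewise_continuous :: "(real \<Rightarrow> 'b::topological_space) \<Rightarrow> bool" where
  "piecewise_continuous v \<longleftrightarrow> (\<forall>b. finite (discontinuities v \<inter> {0..b}))"

text \<open>\<open>x\<close> is a solution on the interval \<open>J\<close> of \<open>x' = F t x\<close> in \<open>D\<^sup>N\<close>. For right-hand sides
  with a piecewise continuous input the equation is required outside the set \<open>E\<close> of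
  discontinuities of the input; \<open>E = {}\<close> gives classical solutions. Since the right-hand sides
  are only given on \<open>D\<^sup>N\<close>, being a solution includes staying in \<open>D\<^sup>N\<close>.\<close>

definition solution_on ::
    "(real ^ 'n) set \<Rightarrow> (real \<Rightarrow> real ^ 'n ^ 'a \<Rightarrow> real ^ 'n ^ 'a::finite) \<Rightarrow> real set \<Rightarrow>
     real set \<Rightarrow> (real \<Rightarrow> real ^ 'n ^ 'a) \<Rightarrow> bool" where
  "solution_on D F E J x \<longleftrightarrow>
     continuous_on J x \<and> (\<forall>t\<in>J. x t \<in> configs D) \<and>
     (\<forall>t\<in>J - E. (x has_vector_derivative F t (x t)) (at t within J))"

text \<open>\<open>x\<close> is, on \<open>J\<close>, the solution with initial value \<open>x0\<close>: any other solution
  coincides with it as long as it exists.\<close>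

definition unique_solution_on ::
    "(real ^ 'n) set \<Rightarrow> (real \<Rightarrow> real ^ 'n ^ 'a \<Rightarrow> real ^ 'n ^ 'a::finite) \<Rightarrow> real set \<Rightarrow>
     real set \<Rightarrow> real ^ 'n ^ 'a \<Rightarrow> (real \<Rightarrow> real ^ 'n ^ 'a) \<Rightarrow> bool" where
  "unique_solution_on D F E J x0 x \<longleftrightarrow>
     solution_on D F E J x \<and> x 0 = x0 \<and>
     (\<forall>J' y. is_interval J' \<longrightarrow> 0 \<in> J' \<longrightarrow> J' \<subseteq> J \<longrightarrow> solution_on D F E J' y \<longrightarrow> y 0 = x0 \<longrightarrow>
        (\<forall>t\<in>J'. y t = x t))"

definition drift ::
    "('a \<Rightarrow> 'a list) \<Rightarrow> ('a \<Rightarrow> (real ^ 'n) list \<Rightarrow> real ^ 'n) \<Rightarrow>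
     real ^ 'n ^ 'a \<Rightarrow> real ^ 'n ^ 'a::finite" where
  "drift nb f x = (\<chi> i. f i (pr nb i (($) x)))"

definition open_loop ::
    "('a \<Rightarrow> 'a list) \<Rightarrow> ('a \<Rightarrow> (real ^ 'n) list \<Rightarrow> real ^ 'n) \<Rightarrow> (real \<Rightarrow> real ^ 'n ^ 'a) \<Rightarrow>
     real \<Rightarrow> real ^ 'n ^ 'a \<Rightarrow> real ^ 'n ^ 'a::finite" where
  "open_loop nb f v t x = drift nb f x + v t"

definition admissible_input :: "real \<Rightarrow> (real \<Rightarrow> real ^ 'n ^ 'a::finite) \<Rightarrow> bool" where
  "admissible_input vmax v \<longleftrightarrow>
     piecewise_continuous v \<and> (\<forall>t\<ge>0. \<forall>i. norm (v t $ i) \<le> vmax)"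

definition invariance_assumption ::
    "(real ^ 'n) set \<Rightarrow> ('a::finite \<Rightarrow> 'a list) \<Rightarrow> ('a \<Rightarrow> (real ^ 'n) list \<Rightarrow> real ^ 'n) \<Rightarrow>
     real \<Rightarrow> bool" where
  "invariance_assumption D nb f vmax \<longleftrightarrow>
     (\<forall>x0\<in>configs D. \<forall>v. admissible_input vmax v \<longrightarrow>
        (\<exists>x. unique_solution_on D (open_loop nb f v) (discontinuities v) {0..} x0 x))"

text \<open>A feedback law of one agent for its cell configuration \<open>c = [l\<^sub>i, l\<^sub>j\<^sub>1, ...]\<close> consists of
  \<open>T xi0 wi\<close>, possibly infinite, and \<open>k t X xi0 wi\<close>, relevant for \<open>0 \<le> t < T xi0 wi\<close> and
  \<open>X \<in> D\<^sup>m\<close> with \<open>m = length c\<close>, where \<open>xi0 \<in> S (c ! 0)\<close> and \<open>wi \<in> W\<close>.\<close>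

type_synonym 'n law = "real \<Rightarrow> (real ^ 'n) list \<Rightarrow> real ^ 'n \<Rightarrow> real ^ 'n \<Rightarrow> real ^ 'n"
type_synonym 'n horizon = "real ^ 'n \<Rightarrow> real ^ 'n \<Rightarrow> ereal"

definition feedback_horizon ::
    "('c \<Rightarrow> (real ^ 'n) set) \<Rightarrow> (real ^ 'n) set \<Rightarrow> 'c list \<Rightarrow> 'n horizon \<Rightarrow> bool" where
  "feedback_horizon S W c T \<longleftrightarrow> (\<forall>xi0\<in>S (c ! 0). \<forall>wi\<in>W. 0 < T xi0 wi)"

definition P1 ::
    "(real ^ 'n) set \<Rightarrow> ('c \<Rightarrow> (real ^ 'n) set) \<Rightarrow> (real ^ 'n) set \<Rightarrow> 'c list \<Rightarrow>
     'n horizon \<Rightarrow> 'n law \<Rightarrow> bool" where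
  "P1 D S W c T k \<longleftrightarrow>
     (\<forall>xi0\<in>S (c ! 0). \<forall>wi\<in>W.
        locally_lipschitz_wrt time_tuple_dist
          ({t. 0 \<le> t \<and> ereal t < T xi0 wi} \<times> tuples D (length c))
          (\<lambda>(t, X). k t X xi0 wi))"

definition P2 ::
    "(real ^ 'n) set \<Rightarrow> ('c \<Rightarrow> (real ^ 'n) set) \<Rightarrow> (real ^ 'n) set \<Rightarrow> real \<Rightarrow> real \<Rightarrow> real \<Rightarrow>
     'c list \<Rightarrow> 'n horizon \<Rightarrow> 'n law \<Rightarrow> bool" where
  "P2 D S W \<delta>t M vmax c T k \<longleftrightarrow>
     (let Rmax = \<delta>t * (M + vmax) in
      \<forall>xi0\<in>S (c ! 0). \<forall>wi\<in>W. \<forall>t X.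
        0 \<le> t \<longrightarrow> t \<le> \<delta>t \<longrightarrow> ereal t < T xi0 wi \<longrightarrow>
        length X = length c \<longrightarrow> (\<forall>m<length c. X ! m \<in> (S (c ! m) + cball 0 Rmax) \<inter> D) \<longrightarrow>
        norm (k t X xi0 wi) \<le> vmax)"

definition P3 ::
    "('c \<Rightarrow> (real ^ 'n) set) \<Rightarrow> (real ^ 'n) set \<Rightarrow> real \<Rightarrow> 'c list \<Rightarrow> 'n horizon \<Rightarrow> bool" where
  "P3 S W \<delta>t c T \<longleftrightarrow> (\<forall>xi0\<in>S (c ! 0). \<forall>wi\<in>W. ereal \<delta>t < T xi0 wi)"

definition closed_loop ::
    "('a \<Rightarrow> 'a list) \<Rightarrow> ('a \<Rightarrow> (real ^ 'n) list \<Rightarrow> real ^ 'n) \<Rightarrow> ('a \<Rightarrow> 'n law) \<Rightarrow>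
     real ^ 'n ^ 'a \<Rightarrow> ('a \<Rightarrow> real ^ 'n) \<Rightarrow> real \<Rightarrow> real ^ 'n ^ 'a \<Rightarrow> real ^ 'n ^ 'a::finite" where
  "closed_loop nb f k x0 w t x =
     drift nb f x + (\<chi> i. k i t (pr nb i (($) x)) (x0 $ i) (w i))"

text \<open>The time \<open>min {\<delta>t, min {T\<^sub>i (x\<^sub>i\<^sub>0, w\<^sub>i) | i}}\<close>; finite, as it is at most \<open>\<delta>t\<close>.\<close>

definition end_time ::
    "real \<Rightarrow> ('a::finite \<Rightarrow> 'n horizon) \<Rightarrow> real ^ 'n ^ 'a \<Rightarrow> ('a \<Rightarrow> real ^ 'n) \<Rightarrow> real" where
  "end_time \<delta>t T x0 w = real_of_ereal (min (ereal \<delta>t) (Min (range (\<lambda>i. T i (x0 $ i) (w i)))))"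

end

theory Submission
  imports Defs
begin

text \<open>Along a closed-loop solution starting in the given cells, the feedback is bounded by
  \<open>vmax\<close> as long as every agent is within \<open>Rmax\<close> of its initial position. Each velocity is then
  at most \<open>M + vmax\<close>, so no agent can leave that ball before the time \<open>\<delta>t\<close>. The closed-loop
  solution on \<open>[0, \<sigma>)\<close> is therefore also the open-loop solution for an admissible input, namely
  the feedback evaluated along it, continued by zero. By invariance the open-loop solution is
  global and stays in \<open>D\<^sup>N\<close>, so the closed-loop solution has a limit in \<open>D\<^sup>N\<close> at \<open>\<sigma>\<close> and can be
  extended by the local existence theorem, until the end of the horizon is reached.\<close>

section \<open>Locally Lipschitz maps\<close>

text \<open>The obstacle is circular: (P2) bounds the feedback only while the agents stay in the
  enlarged cells, and staying there is what the bound is to give. The circle is broken at the first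
  time at which some agent, whichever it is, has moved by \<open>Rmax\<close>; the constant
  \<open>\<delta>t * (M + vmax)\<close> is the distance that takes the whole time step at top speed.
  A second obstacle is the end of the horizon: (P1) says nothing at \<open>T\<close>, so the control
  may oscillate as that time is approached. The limit of the state is therefore read off from the
  open-loop solution, which is continuous past that time. The open-loop solution built for the full
  end time finally serves as the witness for every claim: it agrees with the closed loop before the
  end time and already has the right value at it, so the coincidence in (iib) becomes an
  identity.\<close>

lemma locally_lipschitz_wrtE:
  assumes "locally_lipschitz_wrt d A g" "p \<in> A"
  obtains r L where "0 < r" "0 \<le> L"
    "\<And>q q'. q \<in> A \<Longrightarrow> q' \<in> A \<Longrightarrow> d p q < r \<Longrightarrow> d p q' < r \<Longrightarrow> dist (g q) (g q') \<le> L * d q q'"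
  using assms unfolding locally_lipschitz_wrt_def by blast

text \<open>Used to pass from the tuple distances of the hypotheses to the product metric: the
  Lipschitz constant grows by the factor \<open>K\<close> and the radius shrinks by it. The distance
  \<open>d\<close> is a bare function because \<open>tuple_dist\<close> is no metric across
  different lengths.\<close>

lemma locally_lipschitz_wrt_compose:
  assumes g: "locally_lipschitz_wrt d A g"
    and \<phi>: "\<And>p. p \<in> B \<Longrightarrow> \<phi> p \<in> A"
    and K: "0 < K" "\<And>p q. p \<in> B \<Longrightarrow> q \<in> B \<Longrightarrow> d (\<phi> p) (\<phi> q) \<le> K * e p q"
  shows "locally_lipschitz_wrt e B (\<lambda>p. g (\<phi> p))"
  unfolding locally_lipschitz_wrt_def
proof
  fix p assume p: "p \<in> B"
  obtain r L where r: "r > 0" "L \<ge> 0" and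
    L: "\<And>q q'. q \<in> A \<Longrightarrow> q' \<in> A \<Longrightarrow> d (\<phi> p) q < r \<Longrightarrow> d (\<phi> p) q' < r \<Longrightarrow>
      dist (g q) (g q') \<le> L * d q q'"
    using locally_lipschitz_wrtE[OF g \<phi>[OF p]] by blast
  have near: "d (\<phi> p) (\<phi> q) < r" if "q \<in> B" "e p q < r / K" for q
  proof -
    have "K * e p q < r"
      using that K(1) by (simp add: field_simps)
    then show ?thesis
      using K(2)[OF p that(1)] by linarith
  qed
  show "\<exists>r>0. \<exists>L\<ge>0. \<forall>q\<in>B. \<forall>q'\<in>B. e p q < r \<longrightarrow> e p q' < r \<longrightarrow>
      dist (g (\<phi> q)) (g (\<phi> q')) \<le> L * e q q'"
  proof (intro exI conjI ballI impI)
    fix q q' assume q: "q \<in> B" "q' \<in> B" "e p q < r / K" "e p q' < r / K"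
    have "dist (g (\<phi> q)) (g (\<phi> q')) \<le> L * d (\<phi> q) (\<phi> q')"
      using q near \<phi> by (intro L) auto
    also have "\<dots> \<le> L * (K * e q q')"
      using K(2) q r by (intro mult_left_mono) auto
    finally show "dist (g (\<phi> q)) (g (\<phi> q')) \<le> (L * K) * e q q'"
      by (simp add: mult.assoc)
  qed (use r K in auto)
qed

lemma locally_lipschitz_wrt_add:
  fixes g h :: "'p::metric_space \<Rightarrow> 'b::real_normed_vector"
  assumes "locally_lipschitz_wrt dist A g" "locally_lipschitz_wrt dist A h"
  shows "locally_lipschitz_wrt dist A (\<lambda>p. g p + h p)"
  unfolding locally_lipschitz_wrt_def
proof
  fix p assume p: "p \<in> A"
  obtain r L where g: "0 < r" "0 \<le> L" "\<And>q q'. q \<in> A \<Longrightarrow> q' \<in> A \<Longrightarrow> dist p q < r \<Longrightarrow> dist p q' < r \<Longrightarrow>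
      dist (g q) (g q') \<le> L * dist q q'"
    using locally_lipschitz_wrtE[OF assms(1) p] by blast
  obtain r' L' where h: "0 < r'" "0 \<le> L'" "\<And>q q'. q \<in> A \<Longrightarrow> q' \<in> A \<Longrightarrow> dist p q < r' \<Longrightarrow> dist p q' < r' \<Longrightarrow>
      dist (h q) (h q') \<le> L' * dist q q'"
    using locally_lipschitz_wrtE[OF assms(2) p] by blast
  show "\<exists>r>0. \<exists>L\<ge>0. \<forall>q\<in>A. \<forall>q'\<in>A. dist p q < r \<longrightarrow> dist p q' < r \<longrightarrow>
      dist (g q + h q) (g q' + h q') \<le> L * dist q q'"
  proof (intro exI conjI ballI impI)
    fix q q' assume "q \<in> A" "q' \<in> A" "dist p q < min r r'" "dist p q' < min r r'"
    then have "dist (g q) (g q') \<le> L * dist q q'" "dist (h q) (h q') \<le> L' * dist q q'"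
      using g(3) h(3) by auto
    then show "dist (g q + h q) (g q' + h q') \<le> (L + L') * dist q q'"
      using dist_triangle_add[of "g q" "h q" "g q'" "h q'"] by (simp add: algebra_simps)
  qed (use g(1,2) h(1,2) in auto)
qed

text \<open>Finitely many components share the smallest radius, and the Euclidean norm is at most
  the sum of the component norms, so the constants add up.\<close>

lemma locally_lipschitz_wrt_vec:
  fixes g :: "'i::finite \<Rightarrow> 'p::metric_space \<Rightarrow> 'b::real_normed_vector"
  assumes "\<And>i. locally_lipschitz_wrt dist A (g i)"
  shows "locally_lipschitz_wrt dist A (\<lambda>p. \<chi> i. g i p)"
  unfolding locally_lipschitz_wrt_def
proof
  fix p assume p: "p \<in> A"
  have "\<forall>i. \<exists>r. r > 0 \<and> (\<exists>L. L \<ge> 0 \<and> (\<forall>q\<in>A. \<forall>q'\<in>A. dist p q < r \<longrightarrow> dist p q' < r \<longrightarrow>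
      dist (g i q) (g i q') \<le> L * dist q q'))"
    using assms p unfolding locally_lipschitz_wrt_def by blast
  then obtain r L where *: "\<And>i. r i > 0" "\<And>i. L i \<ge> 0"
    "\<And>i q q'. q \<in> A \<Longrightarrow> q' \<in> A \<Longrightarrow> dist p q < r i \<Longrightarrow> dist p q' < r i \<Longrightarrow>
      dist (g i q) (g i q') \<le> L i * dist q q'"
    by metis
  show "\<exists>r>0. \<exists>L\<ge>0. \<forall>q\<in>A. \<forall>q'\<in>A. dist p q < r \<longrightarrow> dist p q' < r \<longrightarrow>
      dist (\<chi> i. g i q) (\<chi> i. g i q') \<le> L * dist q q'"
  proof (intro exI conjI ballI impI)
    show "0 < Min (range r)" "0 \<le> sum L UNIV"
      using * by (auto intro: sum_nonneg)
    fix q q' assume q: "q \<in> A" "q' \<in> A" "dist p q < Min (range r)" "dist p q' < Min (range r)"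
    have "dist (\<chi> i. g i q) (\<chi> i. g i q') \<le> (\<Sum>i\<in>UNIV. dist (g i q) (g i q'))"
      unfolding dist_vec_def by (rule order_trans[OF L2_set_le_sum]) auto
    also have "\<dots> \<le> (\<Sum>i\<in>UNIV. L i * dist q q')"
      using q by (intro sum_mono *(3)) auto
    finally show "dist (\<chi> i. g i q) (\<chi> i. g i q') \<le> sum L UNIV * dist q q'"
      by (simp add: sum_distrib_right)
  qed
qed

lemma locally_lipschitz_wrt_continuous_on:
  fixes g :: "'p::metric_space \<Rightarrow> 'b::metric_space"
  assumes "locally_lipschitz_wrt dist A g"
  shows "continuous_on A g"
  unfolding continuous_on_iff
proof (intro ballI allI impI)
  fix p \<epsilon> assume p: "p \<in> A" and \<epsilon>: "0 < (\<epsilon>::real)"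
  obtain r L where *: "r > 0" "L \<ge> 0"
    "\<And>q q'. q \<in> A \<Longrightarrow> q' \<in> A \<Longrightarrow> dist p q < r \<Longrightarrow> dist p q' < r \<Longrightarrow>
      dist (g q) (g q') \<le> L * dist q q'"
    using locally_lipschitz_wrtE[OF assms p] by blast
  show "\<exists>d>0. \<forall>q\<in>A. dist q p < d \<longrightarrow> dist (g q) (g p) < \<epsilon>"
  proof (intro exI conjI ballI impI)
    \<comment> \<open>\<open>L\<close> may be zero, hence the \<open>+ 1\<close> in the
      denominator.\<close>
    show "0 < min r (\<epsilon> / (L + 1))"
      using *(1,2) \<epsilon> by simp
    fix q assume q: "q \<in> A" "dist q p < min r (\<epsilon> / (L + 1))"
    have "dist (g q) (g p) \<le> L * dist q p"
      using q p *(1) by (intro *(3)) (simp_all add: dist_commute)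
    also have "\<dots> \<le> (L + 1) * dist q p"
      by (simp add: mult_right_mono)
    also have "\<dots> < \<epsilon>"
      using q(2) *(2) by (simp add: pos_less_divide_eq mult.commute)
    finally show "dist (g q) (g p) < \<epsilon>" .
  qed
qed

section \<open>Ordinary differential equations\<close>

text \<open>Mean value inequality with derivatives at interior points only. It turns speed bounds
  into displacement bounds in local existence, in uniqueness and for the agents.\<close>

lemma norm_increment_le:
  fixes x :: "real \<Rightarrow> 'e::real_inner"
  assumes "a \<le> b" "continuous_on {a..b} x"
    and "\<And>t. a < t \<Longrightarrow> t < b \<Longrightarrow> (x has_vector_derivative x' t) (at t)"
    and "\<And>t. a < t \<Longrightarrow> t < b \<Longrightarrow> norm (x' t) \<le> B"
  shows "norm (x b - x a) \<le> B * (b - a)"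
proof (cases "a = b")
  case False
  then have "a < b"
    using assms(1) by simp
  then obtain t where t: "t \<in> {a<..<b}" "norm (x b - x a) \<le> norm ((b - a) *\<^sub>R x' t)"
    using mvt_general[of a b x "\<lambda>t s. s *\<^sub>R x' t"] assms(2,3)
    unfolding has_vector_derivative_def by blast
  have "norm ((b - a) *\<^sub>R x' t) = norm (x' t) * (b - a)"
    using \<open>a < b\<close> by simp
  also have "\<dots> \<le> B * (b - a)"
    using \<open>a < b\<close> t assms(4) by (intro mult_right_mono) auto
  finally show ?thesis
    using t(2) by simp
qed simp

text \<open>This covers both the extension of a differential equation to an endpoint of the interval
  and the gluing of two solutions.\<close>

lemma has_vector_derivative_removable:
  fixes x :: "real \<Rightarrow> 'e::banach"
  assumes "finite E" and x: "continuous_on {a..b} x" and x': "continuous_on {a..b} x'"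
    and deriv: "\<And>t. t \<in> {a<..<b} - E \<Longrightarrow> (x has_vector_derivative x' t) (at t)"
    and t: "t \<in> {a..b}"
  shows "(x has_vector_derivative x' t) (at t within {a..b})"
proof -
  \<comment> \<open>The fundamental theorem tolerates a finite exceptional set, so \<open>x\<close>
    is an integral of the continuous \<open>x'\<close>; such an integral is differentiable at the
    exceptional points and at both ends as well.\<close>
  have eq: "x a + integral {a..u} x' = x u" if "u \<in> {a..b}" for u
  proof -
    have "(x' has_integral (x u - x a)) {a..u}"
      using that by (intro fundamental_theorem_of_calculus_interior_strong[OF \<open>finite E\<close>]
        deriv continuous_on_subset[OF x]) auto
    then show ?thesis
      by (simp add: integral_unique)
  qed
  have "((\<lambda>u. x a + integral {a..u} x') has_vector_derivative 0 + x' t) (at t within {a..b})"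
    by (intro has_vector_derivative_add has_vector_derivative_const
        integral_has_vector_derivative x' t)
  then show ?thesis
    using has_vector_derivative_transform[OF t eq[symmetric]] by simp
qed

section \<open>Existence of solutions (Picard-Lindeloef)\<close>

lemma lipschitz_ode_solution:
  fixes G :: "real \<Rightarrow> 'e::banach \<Rightarrow> 'e"
  assumes G: "\<And>s s' y y'. dist (G s y) (G s' y') \<le> L * dist (s, y) (s', y')"
    and h: "0 \<le> h" "h * L < 1" and L: "0 \<le> L"
  obtains y where "y a = z"
    "\<And>t. t \<in> {a..a+h} \<Longrightarrow> (y has_vector_derivative G t (y t)) (at t within {a..a+h})"
proof -
  \<comment> \<open>The complete space of bounded continuous functions consists of functions on the
    whole line, so time is clamped to \<open>{a..a+h}\<close>; the operator below yields functions
    that are constant outside.\<close>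
  define clip where "clip t = max a (min (a + h) t)" for t :: real
  have clip: "clip t \<in> {a..a+h}" for t
    using h by (auto simp: clip_def)
  have clip_id: "clip t = t" if "t \<in> {a..a+h}" for t
    using that by (auto simp: clip_def)
  have cont_clip: "continuous_on UNIV clip"
    unfolding clip_def by (intro continuous_intros)
  have G': "continuous_on X (\<lambda>s. G s (y s))" if "continuous_on X y" for X y
  proof -
    have "continuous_on UNIV (\<lambda>p. G (fst p) (snd p))"
    proof (rule lipschitz_on_continuous_on, rule lipschitz_onI)
      show "dist (G (fst p) (snd p)) (G (fst q) (snd q)) \<le> L * dist p q" for p q
        using G[of "fst p" "snd p" "fst q" "snd q"] by simp
    qed (rule L)
    from continuous_on_compose2[OF this, of X "\<lambda>s. (s, y s)"] show ?thesis
      using that by (simp add: continuous_on_Pair continuous_on_id)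
  qed
  define \<Phi> where "\<Phi> y t = z + integral {a..clip t} (\<lambda>s. G s (apply_bcontfun y s))"
    for y :: "real \<Rightarrow>\<^sub>C 'e" and t
  have \<Phi>: "\<Phi> y \<in> bcontfun" for y
  proof -
    let ?I = "\<lambda>t. z + integral {a..t} (\<lambda>s. G s (apply_bcontfun y s))"
    have I: "continuous_on {a..a+h} ?I"
      by (intro continuous_intros indefinite_integral_continuous_1 integrable_continuous_real G'
          continuous_on_apply_bcontfun)
    have "continuous_on UNIV (\<Phi> y)"
      unfolding \<Phi>_def using clip by (intro continuous_on_compose2[OF I cont_clip]) auto
    moreover have "bounded (?I ` {a..a+h})"
      by (intro compact_imp_bounded compact_continuous_image I) simp
    then have "bounded (range (\<Phi> y))"
      by (rule bounded_subset) (use clip in \<open>auto simp: \<Phi>_def\<close>)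
    ultimately show ?thesis
      by (simp add: bcontfun_def)
  qed
  have \<Phi>_apply: "apply_bcontfun (Bcontfun (\<Phi> y)) = \<Phi> y" for y
    using \<Phi> by (simp add: Bcontfun_inverse)
  \<comment> \<open>Integrating over a length of at most \<open>h\<close> makes the operator a
    contraction with factor \<open>h * L < 1\<close>; its fixed point solves the integral
    equation.\<close>
  have "dist (Bcontfun (\<Phi> y)) (Bcontfun (\<Phi> y')) \<le> (h * L) * dist y y'" for y y'
  proof (rule dist_bound)
    fix t
    let ?g = "\<lambda>s. G s (apply_bcontfun y s)" and ?g' = "\<lambda>s. G s (apply_bcontfun y' s)"
    have g: "continuous_on {a..clip t} ?g" "continuous_on {a..clip t} ?g'"
      by (intro G' continuous_on_apply_bcontfun)+
    have "dist (\<Phi> y t) (\<Phi> y' t) = norm (integral {a..clip t} (\<lambda>s. ?g s - ?g' s))"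
      using g by (simp add: \<Phi>_def dist_norm integral_diff integrable_continuous_real)
    also have "\<dots> \<le> (L * dist y y') * (clip t - a)"
    proof (rule integral_bound)
      show "continuous_on {a..clip t} (\<lambda>s. ?g s - ?g' s)"
        by (intro continuous_intros g)
      fix s
      have "norm (?g s - ?g' s) \<le> L * dist (apply_bcontfun y s) (apply_bcontfun y' s)"
        using G[of s "apply_bcontfun y s" s "apply_bcontfun y' s"] by (simp add: dist_norm dist_Pair_Pair)
      also have "\<dots> \<le> L * dist y y'"
        by (intro mult_left_mono dist_bounded L)
      finally show "norm (?g s - ?g' s) \<le> L * dist y y'" .
    qed (use clip in auto)
    also have "\<dots> \<le> (L * dist y y') * h"
      using clip[of t] L by (intro mult_left_mono) auto
    finally show "dist (apply_bcontfun (Bcontfun (\<Phi> y)) t) (apply_bcontfun (Bcontfun (\<Phi> y')) t)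
        \<le> (h * L) * dist y y'"
      by (simp add: \<Phi>_apply mult_ac)
  qed
  then have "\<exists>!y. Bcontfun (\<Phi> y) = y"
    using h L by (intro banach_fix_type[of "h * L"]) auto
  then obtain y where "Bcontfun (\<Phi> y) = y"
    by auto
  then have fixpoint: "apply_bcontfun y t = \<Phi> y t" for t
    using \<Phi>_apply[of y] by simp
  show thesis
  proof
    show "apply_bcontfun y a = z"
      using h by (subst fixpoint) (simp add: \<Phi>_def clip_id)
    fix t assume t: "t \<in> {a..a+h}"
    have "((\<lambda>u. z + integral {a..u} (\<lambda>s. G s (apply_bcontfun y s)))
        has_vector_derivative 0 + G t (apply_bcontfun y t)) (at t within {a..a+h})"
      by (intro has_vector_derivative_add has_vector_derivative_const
          integral_has_vector_derivative[where f = "\<lambda>s. G s (apply_bcontfun y s)"] t G' continuous_on_apply_bcontfun)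
    then have deriv: "((\<lambda>u. z + integral {a..u} (\<lambda>s. G s (apply_bcontfun y s)))
        has_vector_derivative G t (apply_bcontfun y t)) (at t within {a..a+h})"
      by simp
    have "apply_bcontfun y u = z + integral {a..u} (\<lambda>s. G s (apply_bcontfun y s))"
      if "u \<in> {a..a+h}" for u
      using that by (subst fixpoint) (simp add: \<Phi>_def clip_id)
    then show "(apply_bcontfun y has_vector_derivative G t (apply_bcontfun y t))
        (at t within {a..a+h})"
      using has_vector_derivative_transform[OF t _ deriv] by blast
  qed
qed

text \<open>Composing with the metric projection onto a small ball makes the
  right-hand side globally Lipschitz, and a short enough solution never leaves the ball.\<close>

lemma local_ode_solution:
  fixes F :: "real \<Rightarrow> 'e::euclidean_space \<Rightarrow> 'e"
  assumes lip: "locally_lipschitz_wrt dist (J \<times> C) (\<lambda>(t, y). F t y)"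
    and C: "open C" "z \<in> C" and h0: "0 < h0" "{a..a+h0} \<subseteq> J"
  obtains h y where "0 < h" "h \<le> h0" "y a = z"
    "\<And>t. t \<in> {a..a+h} \<Longrightarrow>
      y t \<in> C \<and> (y has_vector_derivative F t (y t)) (at t within {a..a+h})"
proof -
  have "(a, z) \<in> J \<times> C"
    using C h0 by auto
  then obtain r L where r: "r > 0" "L \<ge> 0" and
    L': "\<And>q q'. q \<in> J \<times> C \<Longrightarrow> q' \<in> J \<times> C \<Longrightarrow> dist (a, z) q < r \<Longrightarrow> dist (a, z) q' < r \<Longrightarrow>
      dist (case q of (s, y) \<Rightarrow> F s y) (case q' of (s, y) \<Rightarrow> F s y) \<le> L * dist q q'"
    using locally_lipschitz_wrtE[OF lip] by blast
  have L: "dist (F s y) (F s' y') \<le> L * dist (s, y) (s', y')"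
    if "(s, y) \<in> J \<times> C" "(s', y') \<in> J \<times> C" "dist (a, z) (s, y) < r" "dist (a, z) (s', y') < r"
    for s y s' y'
    using L'[OF that] by simp
  obtain r1 where r1: "r1 > 0" "cball z r1 \<subseteq> C"
    using C open_contains_cball by blast
  \<comment> \<open>Since also \<open>h \<le> \<rho>\<close>, clamped time and projected state lie
    within \<open>2 * \<rho> \<le> r / 2\<close> of \<open>(a, z)\<close>, strictly inside the
    region where \<open>L\<close> is valid.\<close>
  define \<rho> where "\<rho> = min r1 (r / 4)"
  have \<rho>: "0 < \<rho>" "cball z \<rho> \<subseteq> C" "4 * \<rho> \<le> r"
    using r1 r by (auto simp: \<rho>_def)
  \<comment> \<open>A speed bound on that region: the value at the centre plus the Lipschitz
    variation over the distance \<open>r\<close>.\<close>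
  define B where "B = norm (F a z) + L * r"
  have B: "0 \<le> B"
    using r by (simp add: B_def)
  \<comment> \<open>The entries keep time inside \<open>J\<close>, keep it near \<open>a\<close>,
    confine the solution to the ball via \<open>B * h \<le> \<rho>\<close>, and give
    \<open>h * L < 1\<close>; the \<open>+ 1\<close> guards against \<open>B = 0\<close> and
    \<open>L = 0\<close>.\<close>
  define h where "h = Min {h0, \<rho>, \<rho> / (B + 1), 1 / (L + 1)}"
  have h: "0 < h" "h \<le> h0" "h \<le> \<rho>" "h \<le> \<rho> / (B + 1)" "h \<le> 1 / (L + 1)"
    using h0 \<rho> B r by (auto simp: h_def)
  have hB: "B * h \<le> \<rho>"
    using h(1,4) B by (simp add: field_simps)
  have hL: "h * L < 1"
    using h(1,5) r by (simp add: field_simps)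
  define clip where "clip t = max a (min (a + h) t)" for t :: real
  define proj where "proj = closest_point (cball z \<rho>)"
  have clip: "clip t \<in> {a..a+h}" for t
    using h by (auto simp: clip_def)
  have clip_id: "clip t = t" if "t \<in> {a..a+h}" for t
    using that by (auto simp: clip_def)
  have proj: "proj y \<in> cball z \<rho>" for y
    unfolding proj_def using \<rho> by (intro closest_point_in_set) auto
  have mem: "(clip s, proj y) \<in> J \<times> C" for s y
    using clip[of s] h h0 proj[of y] \<rho> by auto
  have near: "dist (a, z) (clip s, proj y) < r" for s y
  proof -
    have "dist (a, z) (clip s, proj y) \<le> dist a (clip s) + dist z (proj y)"
      unfolding dist_Pair_Pair by (rule sqrt_sum_squares_le_sum) auto
    also have "\<dots> \<le> h + \<rho>"
      using clip[of s] proj[of y] by (auto simp: dist_real_def)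
    also have "\<dots> < r"
      using h \<rho> by linarith
    finally show ?thesis .
  qed
  have "dist (F (clip s) (proj y)) (F (clip s') (proj y')) \<le> L * dist (s, y) (s', y')"
    for s s' y y'
  proof -
    have "dist (F (clip s) (proj y)) (F (clip s') (proj y'))
        \<le> L * dist (clip s, proj y) (clip s', proj y')"
      by (intro L mem near)
    also have "\<dots> \<le> L * dist (s, y) (s', y')"
    proof (intro mult_left_mono)
      have "dist (clip s) (clip s') \<le> dist s s'"
        by (auto simp: clip_def dist_real_def)
      moreover have "dist (proj y) (proj y') \<le> dist y y'"
        unfolding proj_def using \<rho> by (intro closest_point_lipschitz) auto
      ultimately show "dist (clip s, proj y) (clip s', proj y') \<le> dist (s, y) (s', y')"
        unfolding dist_Pair_Pair by (intro real_sqrt_le_mono add_mono power_mono) auto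
    qed (use r in simp)
    finally show ?thesis .
  qed
  then obtain y where y: "y a = z" "\<And>t. t \<in> {a..a+h} \<Longrightarrow>
      (y has_vector_derivative F (clip t) (proj (y t))) (at t within {a..a+h})"
    using lipschitz_ode_solution[of "\<lambda>s y. F (clip s) (proj y)" L h a z] h(1) hL r(2)
      less_imp_le by blast
  have bound: "norm (F (clip s) (proj u)) \<le> B" for s u
  proof -
    have "dist (F (clip s) (proj u)) (F a z) \<le> L * dist (clip s, proj u) (a, z)"
      using C h0 near r by (intro L mem) auto
    also have "\<dots> \<le> L * r"
      using near[of s u] r by (intro mult_left_mono) (auto simp: dist_commute)
    finally show ?thesis
      using norm_triangle_ineq2[of "F (clip s) (proj u)" "F a z"] by (simp add: B_def dist_norm)
  qed
  have cont: "continuous_on {a..a+h} y"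
    using y(2) has_vector_derivative_continuous by (force simp: continuous_on_eq_continuous_within)
  have ball: "y t \<in> cball z \<rho>" if t: "t \<in> {a..a+h}" for t
  proof -
    have "norm (y t - y a) \<le> B * (t - a)"
    proof (rule norm_increment_le)
      show "(y has_vector_derivative F (clip s) (proj (y s))) (at s)" if "a < s" "s < t" for s
        using y(2)[of s] that t by (simp add: at_within_Icc_at)
    qed (use t bound continuous_on_subset[OF cont] in auto)
    also have "\<dots> \<le> B * h"
      using t B by (intro mult_left_mono) auto
    finally show ?thesis
      using hB y(1) by (simp add: dist_norm norm_minus_commute)
  qed
  show thesis
  proof (rule that[of h y])
    fix t assume t: "t \<in> {a..a+h}"
    then have "proj (y t) = y t"
      unfolding proj_def using ball by (intro closest_point_self) auto
    then show "y t \<in> C \<and> (y has_vector_derivative F t (y t)) (at t within {a..a+h})"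
      using y(2)[OF t] ball[OF t] \<rho> t by (auto simp: clip_id)
  qed (use h y in auto)
qed

section \<open>Restricting, gluing and completing solutions\<close>

lemma open_configs:
  assumes "open D"
  shows "open (configs D :: (real ^ 'n ^ 'a::finite) set)"
proof -
  have "configs D = (\<Inter>i. (\<lambda>x :: real ^ 'n ^ 'a. x $ i) -` D)"
    by (auto simp: configs_def)
  also have "open \<dots>"
    using assms by (intro open_INT) (auto intro: open_vimage_vec_nth)
  finally show ?thesis .
qed

lemma solution_on_subset:
  assumes "solution_on D F E J x" "J' \<subseteq> J"
  shows "solution_on D F E J' x"
  using assms unfolding solution_on_def
  by (auto intro: continuous_on_subset has_vector_derivative_within_subset)

lemma solution_on_cong:
  assumes "solution_on D F E J x" "\<And>t. t \<in> J \<Longrightarrow> y t = x t"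
  shows "solution_on D F E J y"
proof -
  have "(y has_vector_derivative F t (y t)) (at t within J)" if "t \<in> J - E" for t
  proof -
    have "(x has_vector_derivative F t (x t)) (at t within J)"
      using assms(1) that by (auto simp: solution_on_def)
    then have "(y has_vector_derivative F t (x t)) (at t within J)"
      by (rule has_vector_derivative_transform[rotated 2]) (use that assms(2) in auto)
    then show ?thesis
      using that assms(2) by simp
  qed
  moreover have "continuous_on J y"
    using assms continuous_on_cong[of J J y x] by (auto simp: solution_on_def)
  ultimately show ?thesis
    using assms by (auto simp: solution_on_def)
qed

text \<open>Being a solution is local in time, because continuity and derivative within
  \<open>J\<close> depend only on a neighborhood. This patches solutions on ever longer closed
  intervals into one on a half-open interval.\<close>

lemma solution_on_union_open:
  assumes "\<And>t. t \<in> J \<Longrightarrow> \<exists>U. open U \<and> t \<in> U \<and> solution_on D F {} (J \<inter> U) x"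
  shows "solution_on D F {} J x"
proof -
  have at: "x t \<in> configs D \<and> continuous (at t within J) x \<and>
      (x has_vector_derivative F t (x t)) (at t within J)" if t: "t \<in> J" for t
  proof -
    obtain U where U: "open U" "t \<in> U" "solution_on D F {} (J \<inter> U) x"
      using assms[OF t] by blast
    have "at t within (J \<inter> U) = at t within J"
      using U by (intro at_within_nhd[of t U]) auto
    moreover have "x t \<in> configs D \<and> continuous (at t within (J \<inter> U)) x \<and>
        (x has_vector_derivative F t (x t)) (at t within (J \<inter> U))"
      using U t by (auto simp: solution_on_def continuous_on_eq_continuous_within)
    ultimately show ?thesis
      by simp
  qed
  then show ?thesis
    by (auto simp: solution_on_def continuous_on_eq_continuous_within)
qed

lemma continuous_on_rhs:
  assumes F: "locally_lipschitz_wrt dist (J \<times> configs D) (\<lambda>(t, y). F t y)"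
    and x: "continuous_on J' x" "\<And>t. t \<in> J' \<Longrightarrow> x t \<in> configs D" and "J' \<subseteq> J"
  shows "continuous_on J' (\<lambda>t. F t (x t))"
proof -
  have "continuous_on J' (\<lambda>t. (\<lambda>(t, y). F t y) (t, x t))"
    by (rule continuous_on_compose2[OF locally_lipschitz_wrt_continuous_on[OF F]])
      (use x \<open>J' \<subseteq> J\<close> in \<open>auto intro!: continuous_on_Pair continuous_on_id\<close>)
  then show ?thesis
    by simp
qed

text \<open>The right-hand side is continuous along \<open>x\<close>, so the equation passes to the
  endpoints and across exceptional times. The lemma serves at the junction of two solutions, at a
  limit point and at \<open>\<delta>t\<close>.\<close>

lemma solution_on_removable:
  fixes x :: "real \<Rightarrow> real ^ 'n ^ 'a::finite"
  assumes F: "locally_lipschitz_wrt dist (J \<times> configs D) (\<lambda>(t, y). F t y)"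
    and ab: "{a..b} \<subseteq> J" and "finite E"
    and x: "continuous_on {a..b} x" "\<And>t. t \<in> {a..b} \<Longrightarrow> x t \<in> configs D"
    and deriv: "\<And>t. t \<in> {a<..<b} - E \<Longrightarrow> (x has_vector_derivative F t (x t)) (at t)"
  shows "solution_on D F {} {a..b} x"
  using has_vector_derivative_removable[OF \<open>finite E\<close> x(1) continuous_on_rhs[OF F x ab] deriv] x
  by (auto simp: solution_on_def)

section \<open>Uniqueness of solutions\<close>

lemma solution_local_unique:
  fixes x y :: "real \<Rightarrow> real ^ 'n ^ 'a::finite"
  assumes F: "locally_lipschitz_wrt dist (J \<times> configs D) (\<lambda>(t, y). F t y)"
    and ab: "a < b" "{a..b} \<subseteq> J"
    and x: "solution_on D F {} {a..b} x" and y: "solution_on D F {} {a..b} y"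
    and eq: "x a = y a"
  obtains c where "a < c" "c \<le> b" "\<And>t. t \<in> {a..c} \<Longrightarrow> x t = y t"
proof -
  have cont: "continuous_on {a..b} x" "continuous_on {a..b} y"
    using x y by (auto simp: solution_on_def)
  have C: "x t \<in> configs D" "y t \<in> configs D" if "t \<in> {a..b}" for t
    using x y that by (auto simp: solution_on_def)
  have "(a, x a) \<in> J \<times> configs D"
    using ab C[of a] by auto
  then obtain r L where r: "r > 0" "L \<ge> 0" and
    L: "\<And>q q'. q \<in> J \<times> configs D \<Longrightarrow> q' \<in> J \<times> configs D \<Longrightarrow> dist (a, x a) q < r \<Longrightarrow>
      dist (a, x a) q' < r \<Longrightarrow>
      dist (case q of (s, y) \<Rightarrow> F s y) (case q' of (s, y) \<Rightarrow> F s y) \<le> L * dist q q'"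
    using locally_lipschitz_wrtE[OF F] by blast
  have near: "\<exists>d>0. \<forall>t\<in>{a..b}. dist t a < d \<longrightarrow> dist (a, x a) (t, u t) < r"
    if "continuous_on {a..b} u" "u a = x a" for u
  proof -
    have "continuous_on {a..b} (\<lambda>t. (t, u t))"
      by (intro continuous_on_Pair continuous_on_id that)
    then show ?thesis
      using r(1) ab(1) that(2) unfolding continuous_on_iff by (fastforce simp: dist_commute)
  qed
  obtain d where d: "d > 0" "\<And>t. t \<in> {a..b} \<Longrightarrow> dist t a < d \<Longrightarrow> dist (a, x a) (t, x t) < r"
    using near[OF cont(1)] by blast
  obtain d' where d': "d' > 0" "\<And>t. t \<in> {a..b} \<Longrightarrow> dist t a < d' \<Longrightarrow> dist (a, x a) (t, y t) < r"
    using near[OF cont(2)] eq by auto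
  \<comment> \<open>Halving \<open>d\<close> and \<open>d'\<close> keeps the closed interval of
    length \<open>h\<close> strictly inside the region where \<open>L\<close> is valid; the last
    entry gives \<open>h * L < 1\<close>.\<close>
  define h where "h = Min {b - a, d / 2, d' / 2, 1 / (L + 1)}"
  have h: "0 < h" "h \<le> b - a" "h < d" "h < d'" "h \<le> 1 / (L + 1)"
    using ab d(1) d'(1) r by (auto simp: h_def min_less_iff_disj)
  have hL: "h * L < 1"
    using h(1,5) r by (simp add: field_simps)
  define c where "c = a + h"
  have c: "a < c" "c \<le> b"
    using h by (auto simp: c_def)
  have cont_c: "continuous_on {a..c} (\<lambda>t. x t - y t)"
    using c by (intro continuous_intros continuous_on_subset[OF cont(1)]
        continuous_on_subset[OF cont(2)]) auto
  then have "continuous_on {a..c} (\<lambda>t. norm (x t - y t))"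
    by (rule continuous_on_norm)
  \<comment> \<open>At a point \<open>m\<close> of largest deviation the mean value inequality
    bounds this deviation by \<open>h * L < 1\<close> times itself, so it vanishes.\<close>
  then obtain m where m: "m \<in> {a..c}" "\<And>t. t \<in> {a..c} \<Longrightarrow> norm (x t - y t) \<le> norm (x m - y m)"
    using continuous_attains_sup[of "{a..c}" "\<lambda>t. norm (x t - y t)"] c by auto
  have "norm ((x m - y m) - (x a - y a)) \<le> (L * norm (x m - y m)) * (m - a)"
  proof (rule norm_increment_le)
    show "continuous_on {a..m} (\<lambda>t. x t - y t)"
      using m by (intro continuous_on_subset[OF cont_c]) auto
    fix t assume t: "a < t" "t < m"
    have deriv: "(u has_vector_derivative F t (u t)) (at t)" if "solution_on D F {} {a..b} u" for u
    proof -
      have "(u has_vector_derivative F t (u t)) (at t within {a..b})"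
        using that t m c by (auto simp: solution_on_def)
      then show ?thesis
        using t m c by (simp add: at_within_Icc_at)
    qed
    show "((\<lambda>t. x t - y t) has_vector_derivative F t (x t) - F t (y t)) (at t)"
      by (intro has_vector_derivative_diff deriv x y)
    have t': "t \<in> {a..b}" "dist t a < d" "dist t a < d'"
      using t m(1) c h by (auto simp: dist_real_def c_def)
    have "dist (F t (x t)) (F t (y t)) \<le> L * dist (t, x t) (t, y t)"
      using L[of "(t, x t)" "(t, y t)"] t' C[OF t'(1)] d(2) d'(2) ab by auto
    also have "\<dots> \<le> L * norm (x m - y m)"
      using m t r by (intro mult_left_mono) (auto simp: dist_Pair_Pair dist_norm)
    finally show "norm (F t (x t) - F t (y t)) \<le> L * norm (x m - y m)"
      by (simp add: dist_norm)
  qed (use m in auto)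
  also have "\<dots> \<le> (L * norm (x m - y m)) * h"
    using m r by (intro mult_left_mono) (auto simp: c_def)
  finally have "norm (x m - y m) * (1 - h * L) \<le> 0"
    using eq by (simp add: algebra_simps)
  then have "norm (x m - y m) \<le> 0"
    using hL by (simp add: mult_le_0_iff)
  then have "x t = y t" if "t \<in> {a..c}" for t
    using m(2)[OF that] by simp
  then show thesis
    using that c by blast
qed

text \<open>Argue at the infimum \<open>b\<close> of the times of disagreement: the solutions agree
  before \<open>b\<close>, by continuity also at \<open>b\<close>, and then a little beyond by local
  uniqueness.\<close>

lemma solution_unique:
  fixes x y :: "real \<Rightarrow> real ^ 'n ^ 'a::finite"
  assumes F: "locally_lipschitz_wrt dist (J \<times> configs D) (\<lambda>(t, y). F t y)"
    and J': "is_interval J'" "a \<in> J'" "J' \<subseteq> J"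
    and x: "solution_on D F {} J' x" and y: "solution_on D F {} J' y"
    and eq: "x a = y a" and t: "t \<in> J'" "a \<le> t"
  shows "x t = y t"
proof (rule ccontr)
  assume neq: "x t \<noteq> y t"
  have sub: "{a..t} \<subseteq> J'"
    using mem_is_interval_1_I[OF J'(1,2) t(1)] by auto
  have cont: "continuous_on {a..t} x" "continuous_on {a..t} y"
    using x y continuous_on_subset[OF _ sub] by (auto simp: solution_on_def)
  define N where "N = {s \<in> {a..t}. x s \<noteq> y s}"
  define b where "b = Inf N"
  have N: "t \<in> N" "bdd_below N" "N \<subseteq> {a..t}"
    using neq t by (auto simp: N_def intro: bdd_belowI[of _ a])
  have b: "a \<le> b" "b \<le> t"
    using N unfolding b_def by (auto intro!: cInf_greatest cInf_lower)
  have below: "x s = y s" if "s \<in> {a..<b}" for s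
    using that cInf_lower[OF _ N(2), of s] b by (force simp: N_def b_def)
  have "x b = y b"
  proof (cases "a = b")
    case False
    have "closed ({a..t} \<inter> (\<lambda>s. x s - y s) -` {0})"
      by (intro continuous_closed_preimage continuous_intros cont)
    moreover have "{a..<b} \<subseteq> {a..t} \<inter> (\<lambda>s. x s - y s) -` {0}"
      using below b by auto
    ultimately have "closure {a..<b} \<subseteq> {a..t} \<inter> (\<lambda>s. x s - y s) -` {0}"
      by (intro closure_minimal)
    then show ?thesis
      using False b by auto
  qed (use eq in simp)
  then have "b < t"
    using neq b by (cases "b = t") auto
  have bt: "{b..t} \<subseteq> J'"
    using sub b(1) by auto
  obtain c where c: "b < c" "c \<le> t" "\<And>s. s \<in> {b..c} \<Longrightarrow> x s = y s"
  proof (rule solution_local_unique[OF F, of b t x y])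
    show "{b..t} \<subseteq> J" "solution_on D F {} {b..t} x" "solution_on D F {} {b..t} y"
      using solution_on_subset[OF x bt] solution_on_subset[OF y bt] bt J'(3) by auto
  qed (use \<open>b < t\<close> \<open>x b = y b\<close> in auto)
  have "c \<le> Inf N"
  proof (rule cInf_greatest)
    fix s assume "s \<in> N"
    then show "c \<le> s"
      using below[of s] c(3)[of s] by (force simp: N_def)
  qed (use N in auto)
  then show False
    using c by (simp add: b_def)
qed

section \<open>Continuation of solutions\<close>

lemma solution_extend:
  fixes x :: "real \<Rightarrow> real ^ 'n ^ 'a::finite"
  assumes F: "locally_lipschitz_wrt dist (J \<times> configs D) (\<lambda>(t, y). F t y)" and "open D"
    and ab: "a \<le> b" "b < c" "{a..c} \<subseteq> J" and x: "solution_on D F {} {a..b} x"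
  obtains b' y where "b < b'" "b' \<le> c" "solution_on D F {} {a..b'} y" "y a = x a"
proof -
  obtain h y where h: "0 < h" "h \<le> c - b" "y b = x b" and
    y: "\<And>t. t \<in> {b..b+h} \<Longrightarrow> y t \<in> configs D \<and>
      (y has_vector_derivative F t (y t)) (at t within {b..b+h})"
  proof (rule local_ode_solution[OF F open_configs[OF \<open>open D\<close>], of "x b" "c - b" b])
    show "x b \<in> configs D"
      using x ab by (auto simp: solution_on_def)
  qed (use ab in auto)
  define z where "z t = (if t \<le> b then x t else y t)" for t
  have z_y: "z t = y t" if "b \<le> t" for t
    using that h(3) by (auto simp: z_def)
  have x_cont: "continuous_on {a..b} x"
    using x by (auto simp: solution_on_def)
  have y_cont: "continuous_on {b..b+h} y"
    using y has_vector_derivative_continuous by (force simp: continuous_on_eq_continuous_within)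
  \<comment> \<open>Only the junction \<open>b\<close> is exceptional; on either side of it
    \<open>z\<close> coincides locally with \<open>x\<close> or with \<open>y\<close>.\<close>
  have "solution_on D F {} {a..b+h} z"
  proof (rule solution_on_removable[OF F])
    have "continuous_on ({a..b} \<union> {b..b+h}) z"
    proof (rule continuous_on_closed_Un)
      show "continuous_on {a..b} z"
        using x_cont by (rule continuous_on_eq) (simp add: z_def)
      show "continuous_on {b..b+h} z"
        using y_cont by (rule continuous_on_eq) (simp add: z_y)
    qed auto
    moreover have "{a..b} \<union> {b..b+h} = {a..b+h}"
      using ab(1) h(1) by (intro ivl_disj_un_two_touch) auto
    ultimately show "continuous_on {a..b+h} z"
      by simp
    show "z t \<in> configs D" if "t \<in> {a..b+h}" for t
      using that x y by (cases "t \<le> b") (auto simp: z_def solution_on_def)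
    show "finite {b}" "{a..b+h} \<subseteq> J"
      using ab h by auto
    fix t assume t: "t \<in> {a<..<b+h} - {b}"
    show "(z has_vector_derivative F t (z t)) (at t)"
    proof (cases "t < b")
      case True
      have "(x has_vector_derivative F t (x t)) (at t within {a..b})"
        using True t x by (auto simp: solution_on_def)
      then have "(x has_vector_derivative F t (x t)) (at t)"
        using True t by (simp add: at_within_Icc_at)
      then have "(z has_vector_derivative F t (x t)) (at t)"
        by (rule has_vector_derivative_transform_within_open[where S = "{..<b}"])
          (use True in \<open>auto simp: z_def\<close>)
      then show ?thesis
        using True by (simp add: z_def)
    next
      case False
      have "(y has_vector_derivative F t (y t)) (at t within {b..b+h})"
        using False t y by auto
      then have "(y has_vector_derivative F t (y t)) (at t)"
        using False t by (simp add: at_within_Icc_at)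
      then have "(z has_vector_derivative F t (y t)) (at t)"
        by (rule has_vector_derivative_transform_within_open[where S = "{b<..}"])
          (use False t in \<open>auto simp: z_def\<close>)
      then show ?thesis
        using False by (simp add: z_y)
    qed
  qed
  then show thesis
    using that[of "b + h" z] h ab by (auto simp: z_def)
qed

text \<open>The hypothesis that solutions have limits is an a priori bound: it excludes that a maximal
  solution ends before the time \<open>e\<close>.\<close>

lemma solution_exists_until:
  fixes x0 :: "real ^ 'n ^ 'a::finite"
  assumes F: "locally_lipschitz_wrt dist (J \<times> configs D) (\<lambda>(t, y). F t y)" and "open D"
    and e: "{0..<e} \<subseteq> J" and x0: "x0 \<in> configs D"
    and lim: "\<And>\<sigma> x. 0 < \<sigma> \<Longrightarrow> \<sigma> < e \<Longrightarrow> solution_on D F {} {0..<\<sigma>} x \<Longrightarrow> x 0 = x0 \<Longrightarrow>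
      \<exists>z\<in>configs D. (x \<longlongrightarrow> z) (at_left \<sigma>)"
  obtains x where "solution_on D F {} {0..<e} x" "x 0 = x0"
proof -
  define sol where "sol \<tau> x \<longleftrightarrow> solution_on D F {} {0..\<tau>} x \<and> x 0 = x0" for \<tau> x
  define A where "A = {\<tau> \<in> {0..<e}. \<exists>x. sol \<tau> x}"
  \<comment> \<open>For each \<open>t\<close> some solution on \<open>{0..t}\<close> is chosen;
    uniqueness makes the values fit together into one function that extends every solution
    (\<open>X_eq\<close>).\<close>
  define X where "X t = (SOME x. sol t x) t" for t
  have X_eq: "X t = x t" if "sol \<tau> x" "t \<in> {0..\<tau>}" "\<tau> < e" for x t \<tau>
  proof -
    have x: "sol t x"
      using that solution_on_subset[of D F "{}" "{0..\<tau>}" x "{0..t}"] by (auto simp: sol_def)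
    then have some: "sol t (SOME x. sol t x)"
      by (rule someI[of "sol t"])
    show ?thesis
      unfolding X_def
    proof (rule solution_unique[OF F is_interval_cc[of 0 t],
          where x = "SOME x. sol t x" and y = x and a = 0])
      show "{0..t} \<subseteq> J"
        using e that(2,3) by (auto simp: subset_iff)
      show "solution_on D F {} {0..t} (SOME x. sol t x)" "solution_on D F {} {0..t} x"
        "(SOME x. sol t x) 0 = x 0"
        using some x by (simp_all add: sol_def)
    qed (use that(2) in simp_all)
  qed
  have X_sol: "solution_on D F {} {0..<\<sigma>} X" if A: "\<And>t. t \<in> {0..<\<sigma>} \<Longrightarrow> \<exists>\<tau>>t. \<tau> \<in> A" for \<sigma>
  proof (rule solution_on_union_open)
    fix t assume "t \<in> {0..<\<sigma>}"
    then obtain \<tau> x where \<tau>: "\<tau> > t" "sol \<tau> x" "\<tau> < e"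
      using A[of t] by (auto simp: A_def)
    have "solution_on D F {} {0..\<tau>} X"
      by (rule solution_on_cong[of D F "{}" "{0..\<tau>}" x]) (use \<tau> X_eq in \<open>auto simp: sol_def\<close>)
    then have "solution_on D F {} ({0..<\<sigma>} \<inter> {..<\<tau>}) X"
      by (rule solution_on_subset) auto
    then show "\<exists>U. open U \<and> t \<in> U \<and> solution_on D F {} ({0..<\<sigma>} \<inter> U) X"
      using \<tau> by (intro exI[of _ "{..<\<tau>}"]) auto
  qed
  have A_0: "0 \<in> A" if "0 < e"
  proof -
    have "solution_on D F {} {0..0} (\<lambda>_. x0)"
      by (rule solution_on_removable[OF F, where E = "{}"]) (use that e x0 in auto)
    then show ?thesis
      using that by (auto simp: A_def sol_def)
  qed
  have X_0: "X 0 = x0" if "0 < e"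
    using A_0[OF that] X_eq[of 0 _ 0] that by (auto simp: A_def sol_def)
  have extend: "\<exists>\<tau>>\<sigma>. \<tau> \<in> A" if \<sigma>_A: "\<sigma> \<in> A" for \<sigma>
  proof -
    obtain x where x: "sol \<sigma> x" and \<sigma>: "0 \<le> \<sigma>" "\<sigma> < e"
      using \<sigma>_A by (auto simp: A_def)
    \<comment> \<open>The midpoint of \<open>\<sigma>\<close> and \<open>e\<close> is the target
      because \<open>J\<close> is only known to contain \<open>{0..<e}\<close>, while a closed
      interval inside \<open>J\<close> is required.\<close>
    obtain b y where "\<sigma> < b" "b \<le> (\<sigma> + e) / 2" "solution_on D F {} {0..b} y" "y 0 = x 0"
    proof (rule solution_extend[OF F \<open>open D\<close>, of 0 \<sigma> "(\<sigma> + e) / 2" x])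
      show "{0..(\<sigma> + e) / 2} \<subseteq> J"
        using e \<sigma> by (auto simp: field_simps)
    qed (use \<sigma> x in \<open>auto simp: sol_def\<close>)
    then show ?thesis
      using x \<sigma> by (intro exI[of _ b]) (auto simp: A_def sol_def)
  qed
  have down: "s \<in> A" if "\<tau> \<in> A" "0 \<le> s" "s \<le> \<tau>" for s \<tau>
    using that solution_on_subset[of D F "{}" "{0..\<tau>}" _ "{0..s}"]
    by (auto simp: A_def sol_def)
  have all: "t \<in> A" if t: "t \<in> {0..<e}" for t
  proof (rule ccontr)
    assume "t \<notin> A"
    \<comment> \<open>Every element of \<open>A\<close> can be exceeded within \<open>A\<close>, so
      the supremum lies outside \<open>A\<close>; the limit at \<open>\<sigma>\<close> will put it
      into \<open>A\<close> nevertheless.\<close>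
    define \<sigma> where "\<sigma> = Sup A"
    have "0 < e"
      using t by auto
    have A: "A \<noteq> {}" "bdd_above A" "\<And>s. s \<in> A \<Longrightarrow> s \<le> t"
      using A_0[OF \<open>0 < e\<close>] down[of _ t] \<open>t \<notin> A\<close> t
      by (auto simp: intro!: bdd_aboveI[of _ t]) (meson linear)+
    have "\<sigma> \<le> t"
      unfolding \<sigma>_def using A by (intro cSup_least) auto
    have "\<sigma> \<notin> A"
      using extend[of \<sigma>] cSup_upper[OF _ A(2)] by (force simp: \<sigma>_def)
    have "0 \<le> \<sigma>"
      unfolding \<sigma>_def using A A_0[OF \<open>0 < e\<close>] by (intro cSup_upper) auto
    then have "0 < \<sigma>"
      using \<open>\<sigma> \<notin> A\<close> A_0[OF \<open>0 < e\<close>] by (cases "\<sigma> = 0") auto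
    have sol: "solution_on D F {} {0..<\<sigma>} X"
    proof (rule X_sol)
      fix s assume "s \<in> {0..<\<sigma>}"
      then show "\<exists>\<tau>>s. \<tau> \<in> A"
        using less_cSupD[OF A(1), of s] by (auto simp: \<sigma>_def)
    qed
    obtain z where z: "z \<in> configs D" "(X \<longlongrightarrow> z) (at_left \<sigma>)"
      using lim[OF \<open>0 < \<sigma>\<close> _ sol X_0] \<open>\<sigma> \<le> t\<close> t by auto
    \<comment> \<open>No solution reaches \<open>\<sigma> \<notin> A\<close>, so
      \<open>X \<sigma>\<close> is an arbitrary value and is replaced by the limit.\<close>
    define Y where "Y = X(\<sigma> := z)"
    have Y_sol: "solution_on D F {} {0..<\<sigma>} Y"
      by (rule solution_on_cong[OF sol]) (simp add: Y_def)
    have "solution_on D F {} {0..\<sigma>} Y"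
    proof (rule solution_on_removable[OF F])
      show "continuous_on {0..\<sigma>} Y"
        unfolding continuous_on_eq_continuous_within
      proof
        fix s assume s: "s \<in> {0..\<sigma>}"
        show "continuous (at s within {0..\<sigma>}) Y"
        proof (cases "s = \<sigma>")
          case True
          have "(Y \<longlongrightarrow> z) (at_left \<sigma>)"
            using z(2) by (rule Lim_transform_eventually)
              (auto simp: Y_def eventually_at_filter)
          then show ?thesis
            using True \<open>0 < \<sigma>\<close>
            by (simp add: continuous_within at_within_Icc_at_left Y_def)
        next
          case False
          have "at s within {0..\<sigma>} = at s within {0..<\<sigma>}"
            using False s by (intro at_within_nhd[of s "{..<\<sigma>}"]) auto
          then show ?thesis
            using Y_sol False s
            by (auto simp: solution_on_def continuous_on_eq_continuous_within)
        qed
      qed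
      show "Y s \<in> configs D" if "s \<in> {0..\<sigma>}" for s
        using that Y_sol z by (cases "s = \<sigma>") (auto simp: solution_on_def Y_def)
      show "{0..\<sigma>} \<subseteq> J"
        using e \<open>\<sigma> \<le> t\<close> t by auto
      fix s assume s: "s \<in> {0<..<\<sigma>} - {}"
      have "(Y has_vector_derivative F s (Y s)) (at s within {0..<\<sigma>})"
        using s Y_sol by (auto simp: solution_on_def)
      moreover have "at s within {0..<\<sigma>} = at s"
        using s by (intro at_within_interior) auto
      ultimately show "(Y has_vector_derivative F s (Y s)) (at s)"
        by simp
    qed auto
    then have "\<sigma> \<in> A"
      using \<open>0 < \<sigma>\<close> \<open>\<sigma> \<le> t\<close> t X_0[OF \<open>0 < e\<close>] by (auto simp: A_def sol_def Y_def intro!: exI[of _ Y])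
    then show False
      using \<open>\<sigma> \<notin> A\<close> by blast
  qed
  show thesis
  proof (cases "0 < e")
    case True
    have "solution_on D F {} {0..<e} X"
      using all extend by (intro X_sol) blast
    then show ?thesis
      using that X_0[OF True] by blast
  next
    case False
    then show ?thesis
      using that[of "\<lambda>_. x0"] by (auto simp: solution_on_def)
  qed
qed

section \<open>The multi-agent system\<close>

lemma pr_in_tuples:
  assumes "x \<in> configs D"
  shows "pr nb i (($) x) \<in> tuples D (length (nb i) + 1)"
  using assms by (auto simp: pr_def tuples_def configs_def)

text \<open>Each entry moves by at most the full distance, and the Euclidean norm is at most the
  sum. The factor is crude, but local Lipschitz continuity only asks for some factor.\<close>

lemma tuple_dist_pr_le:
  fixes x y :: "real ^ 'n ^ 'a::finite"
  shows "tuple_dist (pr nb i (($) x)) (pr nb i (($) y)) \<le> real (length (nb i) + 1) * dist x y"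
proof -
  let ?m = "length (nb i) + 1"
  have "tuple_dist (pr nb i (($) x)) (pr nb i (($) y))
      = L2_set (\<lambda>m. dist (x $ ((i # nb i) ! m)) (y $ ((i # nb i) ! m))) {..<?m}"
    unfolding tuple_dist_def pr_def
    by (intro L2_set_cong) (auto simp del: list.map simp: nth_map)
  also have "\<dots> \<le> (\<Sum>m<?m. dist (x $ ((i # nb i) ! m)) (y $ ((i # nb i) ! m)))"
    by (rule L2_set_le_sum) simp
  also have "\<dots> \<le> (\<Sum>m<?m. dist x y)"
    by (intro sum_mono dist_vec_nth_le)
  finally show ?thesis
    by simp
qed

text \<open>The dummy time argument puts the drift on the same product space as the feedback, so
  that the two can be added.\<close>

lemma drift_locally_lipschitz:
  fixes D :: "(real ^ 'n) set" and nb :: "'a::finite \<Rightarrow> 'a list"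
  assumes "\<And>i. locally_lipschitz_wrt tuple_dist (tuples D (length (nb i) + 1)) (f i)"
  shows "locally_lipschitz_wrt dist (J \<times> configs D) (\<lambda>(t :: real, y). drift nb f y)"
proof -
  have "locally_lipschitz_wrt dist (J \<times> configs D) (\<lambda>p. f i (pr nb i (($) (snd p))))" for i
  proof (rule locally_lipschitz_wrt_compose[OF assms, where K = "real (length (nb i) + 1)"])
    fix p q :: "real \<times> (real ^ 'n ^ 'a)"
    have "tuple_dist (pr nb i (($) (snd p))) (pr nb i (($) (snd q)))
        \<le> real (length (nb i) + 1) * dist (snd p) (snd q)"
      by (rule tuple_dist_pr_le)
    also have "\<dots> \<le> real (length (nb i) + 1) * dist p q"
      by (intro mult_left_mono dist_snd_le) simp
    finally show "tuple_dist (pr nb i (($) (snd p))) (pr nb i (($) (snd q)))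
        \<le> real (length (nb i) + 1) * dist p q" .
  next
    fix p :: "real \<times> (real ^ 'n ^ 'a)"
    assume "p \<in> J \<times> configs D"
    then show "pr nb i (($) (snd p)) \<in> tuples D (length (nb i) + 1)"
      by (intro pr_in_tuples) auto
  qed simp
  then show ?thesis
    unfolding drift_def split_beta by (rule locally_lipschitz_wrt_vec)
qed

lemma time_tuple_dist_pr_le:
  fixes p q :: "real \<times> (real ^ 'n ^ 'a::finite)"
  shows "time_tuple_dist (fst p, pr nb i (($) (snd p))) (fst q, pr nb i (($) (snd q)))
    \<le> real (length (nb i) + 1) * dist p q"
proof -
  let ?m = "real (length (nb i) + 1)"
  let ?d = "tuple_dist (pr nb i (($) (snd p))) (pr nb i (($) (snd q)))"
  have "?d\<^sup>2 \<le> (?m * dist (snd p) (snd q))\<^sup>2"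
    by (intro power_mono tuple_dist_pr_le) (simp add: tuple_dist_def)
  \<comment> \<open>The tuple contains the agent itself, so the factor is at least 1 and covers the
    time coordinate too.\<close>
  moreover have "(dist (fst p) (fst q))\<^sup>2 \<le> (?m * dist (fst p) (fst q))\<^sup>2"
    by (intro power_mono) (auto simp: algebra_simps)
  ultimately have "(dist (fst p) (fst q))\<^sup>2 + ?d\<^sup>2
      \<le> ?m\<^sup>2 * ((dist (fst p) (fst q))\<^sup>2 + (dist (snd p) (snd q))\<^sup>2)"
    unfolding power_mult_distrib by (simp add: distrib_left)
  also have "\<dots> = (?m * dist p q)\<^sup>2"
    by (simp add: dist_prod_def power_mult_distrib)
  finally show ?thesis
    unfolding time_tuple_dist_def by (intro real_le_lsqrt) auto
qed

text \<open>Fixing \<open>x0\<close> and \<open>w\<close> turns the closed loop into one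
  differential equation with time-dependent right-hand side. \<open>P3\<close> enters as a premise
  of separate facts, since the first claim concerns the time before the shortest horizon.\<close>

locale feedback_system =
  fixes D :: "(real ^ 'n::finite) set"
    and nb :: "'a::finite \<Rightarrow> 'a list"
    and f :: "'a \<Rightarrow> (real ^ 'n) list \<Rightarrow> real ^ 'n"
    and M vmax \<delta>t :: real
    and S :: "'c \<Rightarrow> (real ^ 'n) set"
    and W :: "(real ^ 'n) set"
    and l :: "'a \<Rightarrow> 'c"
    and T :: "'a \<Rightarrow> 'n horizon"
    and k :: "'a \<Rightarrow> 'n law"
    and x0 :: "real ^ 'n ^ 'a"
    and w :: "'a \<Rightarrow> real ^ 'n"
  assumes D: "open D"
    and f_lipschitz: "\<And>i. locally_lipschitz_wrt tuple_dist (tuples D (length (nb i) + 1)) (f i)"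
    and f_bound: "\<And>i X. X \<in> tuples D (length (nb i) + 1) \<Longrightarrow> norm (f i X) \<le> M"
    and vmax: "0 < vmax" "vmax < M"
    and invariance: "invariance_assumption D nb f vmax"
    and \<delta>t: "0 < \<delta>t"
    and T_pos: "\<And>i. feedback_horizon S W (pr nb i l) (T i)"
    and P1: "\<And>i. P1 D S W (pr nb i l) (T i) (k i)"
    and P2: "\<And>i. P2 D S W \<delta>t M vmax (pr nb i l) (T i) (k i)"
    and x0: "x0 \<in> configs D" "\<And>i. x0 $ i \<in> S (l i)"
    and w: "\<And>i. w i \<in> W"
begin

text \<open>The common time domain of all feedback laws. The feedback is controlled only there, so
  the results on differential equations are applied with \<open>J = times\<close>.\<close>

definition times :: "real set" where
  "times = {t. 0 \<le> t \<and> (\<forall>i. ereal t < T i (x0 $ i) (w i))}"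

definition input :: "real \<Rightarrow> real ^ 'n ^ 'a \<Rightarrow> real ^ 'n ^ 'a" where
  "input t y = (\<chi> i. k i t (pr nb i (($) y)) (x0 $ i) (w i))"

abbreviation rhs :: "real \<Rightarrow> real ^ 'n ^ 'a \<Rightarrow> real ^ 'n ^ 'a" where
  "rhs \<equiv> closed_loop nb f k x0 w"

section \<open>Regularity of the feedback and its size along solutions\<close>

lemma rhs_eq: "rhs t y = drift nb f y + input t y"
  by (simp add: closed_loop_def input_def)

lemma pr_l: "pr nb i l ! 0 = l i" "length (pr nb i l) = length (nb i) + 1"
  by (simp_all add: pr_def)

lemma input_locally_lipschitz:
  "locally_lipschitz_wrt dist (times \<times> configs D) (\<lambda>(t, y). input t y)"
proof -
  have "locally_lipschitz_wrt dist (times \<times> configs D)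
      (\<lambda>p. (\<lambda>(t, X). k i t X (x0 $ i) (w i)) (fst p, pr nb i (($) (snd p))))" for i
  proof (rule locally_lipschitz_wrt_compose[where d = time_tuple_dist
        and A = "{t. 0 \<le> t \<and> ereal t < T i (x0 $ i) (w i)} \<times> tuples D (length (nb i) + 1)"
        and \<phi> = "\<lambda>p. (fst p, pr nb i (($) (snd p)))" and K = "real (length (nb i) + 1)"])
    show "locally_lipschitz_wrt time_tuple_dist
        ({t. 0 \<le> t \<and> ereal t < T i (x0 $ i) (w i)} \<times> tuples D (length (nb i) + 1))
        (\<lambda>(t, X). k i t X (x0 $ i) (w i))"
      using P1[of i] x0(2)[of i] w[of i] by (simp add: P1_def pr_l)
    show "(fst p, pr nb i (($) (snd p)))
        \<in> {t. 0 \<le> t \<and> ereal t < T i (x0 $ i) (w i)} \<times> tuples D (length (nb i) + 1)"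
      if "p \<in> times \<times> configs D" for p
      using that pr_in_tuples[of "snd p" D nb i] by (auto simp: times_def)
  qed (simp, rule time_tuple_dist_pr_le)
  then show ?thesis
    unfolding input_def split_beta fst_conv snd_conv by (rule locally_lipschitz_wrt_vec)
qed

lemma rhs_locally_lipschitz:
  "locally_lipschitz_wrt dist (times \<times> configs D) (\<lambda>(t, y). rhs t y)"
  using locally_lipschitz_wrt_add[OF drift_locally_lipschitz[of D nb f, OF f_lipschitz]
      input_locally_lipschitz]
  by (simp add: rhs_eq case_prod_unfold)

lemma input_bound:
  assumes t: "t \<in> times" "t \<le> \<delta>t" and y: "y \<in> configs D"
    and displacement: "\<And>i. norm (y $ i - x0 $ i) \<le> \<delta>t * (M + vmax)"
  shows "norm (input t y $ i) \<le> vmax"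
proof -
  have "pr nb i (($) y) ! m \<in> (S (pr nb i l ! m) + cball 0 (\<delta>t * (M + vmax))) \<inter> D"
    if m: "m < length (nb i) + 1" for m
  proof -
    let ?j = "(i # nb i) ! m"
    have nth: "pr nb i z ! m = z ?j" for z :: "'a \<Rightarrow> 'z"
      using m unfolding pr_def by (intro nth_map) simp
    \<comment> \<open>The splitting behind the Minkowski sum: the initial position lies in the cell,
      the displacement in the ball.\<close>
    have "y $ ?j = x0 $ ?j + (y $ ?j - x0 $ ?j)"
      by simp
    also have "\<dots> \<in> S (l ?j) + cball 0 (\<delta>t * (M + vmax))"
      by (intro set_plus_intro x0) (use displacement in simp)
    finally show ?thesis
      using y by (simp add: nth configs_def)
  qed
  then show ?thesis
    using P2[of i] x0(2)[of i] w[of i] t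
    by (simp add: P2_def Let_def pr_l input_def times_def) (simp add: pr_def)
qed

text \<open>Before the first time at which some displacement reaches \<open>R\<close>, all inputs
  obey (P2), so all speeds are at most \<open>M + vmax\<close>. Reaching \<open>R\<close> therefore
  takes at least \<open>\<delta>t\<close>.\<close>

lemma displacement_le:
  assumes x: "solution_on D rhs {} {0..t} x" "x 0 = x0" and t: "0 \<le> t" "t \<le> \<delta>t" "{0..t} \<subseteq> times"
  shows "norm (x t $ i - x0 $ i) \<le> \<delta>t * (M + vmax)"
proof (rule ccontr)
  assume far: "\<not> ?thesis"
  define R where "R = \<delta>t * (M + vmax)"
  \<comment> \<open>All agents are taken together because the input bound for one agent needs its
    neighbors to be close as well; closedness provides an earliest time.\<close>
  define P where "P = (\<Union>i. {0..t} \<inter> (\<lambda>s. norm (x s $ i - x0 $ i)) -` {R..})"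
  have cont: "continuous_on {0..t} x"
    using x by (simp add: solution_on_def)
  have cont_i: "continuous_on X (\<lambda>s. x s $ i)" if "X \<subseteq> {0..t}" for i X
    using continuous_on_subset[OF cont that]
    by (rule bounded_linear.continuous_on[OF bounded_linear_vec_nth])
  have "closed P"
    unfolding P_def
  proof (intro closed_UN ballI)
    show "closed ({0..t} \<inter> (\<lambda>s. norm (x s $ i - x0 $ i)) -` {R..})" for i
      by (intro continuous_closed_preimage continuous_intros cont_i) auto
  qed simp
  moreover have "P \<subseteq> {0..t}"
    by (auto simp: P_def)
  moreover have "t \<in> P"
    using far t by (auto simp: P_def R_def not_le intro!: exI[of _ i])
  ultimately obtain s where s: "s \<in> P" "\<And>u. u \<in> P \<Longrightarrow> s \<le> u"
    using compact_attains_inf[of P] bounded_subset[of "{0..t}" P]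
    by (auto simp: compact_eq_bounded_closed)
  have s': "0 \<le> s" "s \<le> t"
    using \<open>P \<subseteq> {0..t}\<close> s(1) by auto
  have move: "norm (x s $ i - x 0 $ i) \<le> (M + vmax) * (s - 0)" for i
  proof (rule norm_increment_le)
    show "continuous_on {0..s} (\<lambda>u. x u $ i)"
      using s' by (intro cont_i) auto
    fix u assume u: "0 < u" "u < s"
    have ut: "u \<in> {0..t}"
      using u s' by auto
    have "(x has_vector_derivative rhs u (x u)) (at u within {0..t})"
      using ut x by (simp add: solution_on_def)
    then have "(x has_vector_derivative rhs u (x u)) (at u)"
      using u s' by (simp add: at_within_Icc_at)
    then show "((\<lambda>u. x u $ i) has_vector_derivative rhs u (x u) $ i) (at u)"
      by (rule bounded_linear.has_vector_derivative[OF bounded_linear_vec_nth])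
    have C: "x u \<in> configs D"
      using x ut by (simp add: solution_on_def)
    have "u \<notin> P"
      using s(2)[of u] u by auto
    then have "norm (x u $ j - x0 $ j) < R" for j
      using ut by (auto simp: P_def not_le)
    then have "norm (input u (x u) $ i) \<le> vmax"
      using ut t(2,3) C by (intro input_bound) (auto simp: R_def less_imp_le subset_iff)
    moreover have "norm (drift nb f (x u) $ i) \<le> M"
      using f_bound[OF pr_in_tuples[OF C]] by (simp add: drift_def)
    ultimately show "norm (rhs u (x u) $ i) \<le> M + vmax"
      unfolding rhs_eq vector_add_component by (intro norm_triangle_le add_mono)
  qed (rule s')
  have "norm (x s $ j - x0 $ j) \<le> (M + vmax) * s" for j
    using move[of j] x(2) by simp
  moreover obtain j where "R \<le> norm (x s $ j - x0 $ j)"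
    using s(1) by (auto simp: P_def)
  ultimately have "R \<le> (M + vmax) * s"
    using order_trans by blast
  \<comment> \<open>So the first time is \<open>t = \<delta>t\<close> itself, where the distance
    travelled is still at most \<open>R\<close>; this contradicts the strict excess in
    \<open>far\<close>.\<close>
  then have "\<delta>t \<le> s"
    using vmax by (simp add: R_def mult.commute)
  then have "s = t"
    using s' t by simp
  have "norm (x t $ i - x0 $ i) \<le> (M + vmax) * t"
    using move[of i] x(2) \<open>s = t\<close> by simp
  also have "\<dots> \<le> (M + vmax) * \<delta>t"
    using t vmax by (intro mult_left_mono) auto
  finally show False
    using far by (simp add: mult.commute)
qed

section \<open>Comparison with the open loop\<close>

lemma input_bound_along_solution:
  assumes x: "solution_on D rhs {} J x" "x 0 = x0"
    and t: "t \<in> J" "{0..t} \<subseteq> J" "J \<subseteq> times" "t \<le> \<delta>t"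
  shows "norm (input t (x t) $ i) \<le> vmax"
proof (rule input_bound)
  show t': "t \<in> times"
    using t by blast
  have sub: "{0..t} \<subseteq> times"
    using t(2,3) by (rule subset_trans)
  show "norm (x t $ i - x0 $ i) \<le> \<delta>t * (M + vmax)" for i
    using t' by (intro displacement_le solution_on_subset[OF x(1) t(2)] x(2) t(4) sub)
      (simp add: times_def)
  show "x t \<in> configs D"
    using x(1) t(1) by (simp add: solution_on_def)
qed (rule t(4))

text \<open>The invariance assumption speaks of inputs that depend on time alone, so the feedback
  has to be frozen along a solution already at hand. The uniqueness in that assumption, applied on
  \<open>{0..<\<sigma>}\<close>, identifies the two solutions.\<close>

lemma coincides_with_open_loop:
  assumes x: "solution_on D rhs {} {0..<\<sigma>} x" "x 0 = x0"
    and \<sigma>: "0 < \<sigma>" "\<sigma> \<le> \<delta>t" "{0..<\<sigma>} \<subseteq> times"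
  obtains v \<xi> where "admissible_input vmax v"
    "unique_solution_on D (open_loop nb f v) (discontinuities v) {0..} x0 \<xi>"
    "\<And>t. t \<in> {0..<\<sigma>} \<Longrightarrow> x t = \<xi> t"
proof -
  \<comment> \<open>The inequality is strict because at \<open>\<sigma>\<close> neither
    \<open>x\<close> nor the laws are under control.\<close>
  define v where "v t = (if t < \<sigma> then input t (x t) else 0)" for t
  have cont: "continuous_on {0..<\<sigma>} v"
  proof -
    have "continuous_on {0..<\<sigma>} (\<lambda>t. input t (x t))"
      using x by (intro continuous_on_rhs[OF input_locally_lipschitz] \<sigma>) (auto simp: solution_on_def)
    then show ?thesis
      by (rule continuous_on_eq) (simp add: v_def)
  qed
  \<comment> \<open>The control may lack a left limit at \<open>\<sigma>\<close>;
    \<open>piecewise_continuous\<close> tolerates this.\<close>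
  have "discontinuities v \<subseteq> {\<sigma>}"
  proof -
    have "continuous (at t within {0..}) v" if t: "0 \<le> t" "t \<noteq> \<sigma>" for t
    proof (cases "t < \<sigma>")
      case True
      have "at t within {0..} = at t within {0..<\<sigma>}"
        using True by (intro at_within_nhd[of t "{..<\<sigma>}"]) auto
      then show ?thesis
        using cont True t by (simp add: continuous_on_eq_continuous_within)
    next
      case False
      have "continuous_on {\<sigma><..} v"
        by (rule continuous_on_eq[OF continuous_on_const[of _ 0]]) (simp add: v_def)
      then have "continuous (at t) v"
        using False t by (simp add: continuous_on_eq_continuous_at)
      then show ?thesis
        by (rule continuous_at_imp_continuous_at_within)
    qed
    then show ?thesis
      by (auto simp: discontinuities_def)
  qed
  then have "piecewise_continuous v"
    unfolding piecewise_continuous_def using finite_subset[of _ "{\<sigma>}"] by blast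
  moreover have "norm (v t $ i) \<le> vmax" if "0 \<le> t" for t i
  proof (cases "t < \<sigma>")
    case True
    then have "norm (input t (x t) $ i) \<le> vmax"
      using that \<sigma> by (intro input_bound_along_solution[OF x]) auto
    then show ?thesis
      using True by (simp add: v_def)
  qed (use vmax in \<open>simp add: v_def\<close>)
  ultimately have v: "admissible_input vmax v"
    by (simp add: admissible_input_def)
  then obtain \<xi> where \<xi>:
    "unique_solution_on D (open_loop nb f v) (discontinuities v) {0..} x0 \<xi>"
    using invariance x0(1) unfolding invariance_assumption_def by blast
  have "solution_on D (open_loop nb f v) (discontinuities v) {0..<\<sigma>} x"
    using x(1) by (auto simp: solution_on_def open_loop_def rhs_eq v_def)
  moreover have "\<forall>J' y. is_interval J' \<longrightarrow> 0 \<in> J' \<longrightarrow> J' \<subseteq> {0..} \<longrightarrow>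
      solution_on D (open_loop nb f v) (discontinuities v) J' y \<longrightarrow> y 0 = x0 \<longrightarrow>
      (\<forall>t\<in>J'. y t = \<xi> t)"
    using \<xi> by (simp add: unique_solution_on_def)
  moreover have "0 \<in> {0..<\<sigma>}" "{0..<\<sigma>} \<subseteq> {0..}"
    using \<sigma>(1) by auto
  ultimately have "\<forall>t\<in>{0..<\<sigma>}. x t = \<xi> t"
    using is_interval_co[of 0 \<sigma>] x(2) by blast
  then show thesis
    using that v \<xi> by blast
qed

text \<open>\<open>times\<close> has no negative elements, so uniqueness forward from 0 is full
  uniqueness.\<close>

lemma unique_solution_on_rhs:
  assumes "solution_on D rhs {} J x" "x 0 = x0" "J \<subseteq> times"
  shows "unique_solution_on D rhs {} J x0 x"
  unfolding unique_solution_on_def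
proof (intro conjI allI impI ballI)
  fix J' y t
  assume J': "is_interval J'" "0 \<in> J'" "J' \<subseteq> J" and y: "solution_on D rhs {} J' y" "y 0 = x0"
    and t: "t \<in> J'"
  have "solution_on D rhs {} J' x"
    using assms(1) J'(3) by (rule solution_on_subset)
  moreover have "J' \<subseteq> times"
    using J'(3) assms(3) by (rule subset_trans)
  moreover have "0 \<le> t"
    using calculation(2) t by (auto simp: times_def)
  moreover have "y 0 = x 0"
    using y(2) assms(2) by simp
  ultimately show "y t = x t"
    using solution_unique[OF rhs_locally_lipschitz J'(1,2) _ y(1)] t by blast
qed (rule assms)+

section \<open>The end time and the assembly of the claims\<close>

definition horizon :: real where
  "horizon = end_time \<delta>t T x0 w"

lemma horizon:
  shows "0 < horizon" "horizon \<le> \<delta>t" "{0..<horizon} \<subseteq> times"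
proof -
  define m where "m = Min (range (\<lambda>i. T i (x0 $ i) (w i)))"
  have m_pos: "0 < m"
    using T_pos x0(2) w by (auto simp: m_def feedback_horizon_def pr_l)
  \<comment> \<open>The minimum is positive and at most \<open>\<delta>t\<close>, hence finite, so
    \<open>real_of_ereal\<close> loses nothing even for infinite horizons.\<close>
  have e: "ereal horizon = min (ereal \<delta>t) m"
    unfolding horizon_def end_time_def m_def[symmetric] using m_pos
    by (cases m) (auto simp: min_def)
  show "0 < horizon"
    using e m_pos \<delta>t by (metis ereal_less(2) min_less_iff_conj)
  show "horizon \<le> \<delta>t"
    using e by (metis ereal_less_eq(3) min.cobounded1)
  show "{0..<horizon} \<subseteq> times"
  proof
    fix t assume t: "t \<in> {0..<horizon}"
    then have "ereal t < m"
      using e by (metis atLeastLessThan_iff ereal_less_eq(3) min_less_iff_conj not_le)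
    then show "t \<in> times"
      using t by (auto simp: times_def m_def)
  qed
qed

text \<open>The strict inequality in \<open>P3\<close> puts the endpoint \<open>\<delta>t\<close>
  itself into the common domain, which allows the equation on the closed interval.\<close>

lemma horizon_P3:
  assumes "\<And>i. P3 S W \<delta>t (pr nb i l) (T i)"
  shows "horizon = \<delta>t" "{0..\<delta>t} \<subseteq> times"
proof -
  have less: "ereal \<delta>t < T i (x0 $ i) (w i)" for i
    using assms[of i] x0(2)[of i] w[of i] by (simp add: P3_def pr_l)
  then have "min (ereal \<delta>t) (Min (range (\<lambda>i. T i (x0 $ i) (w i)))) = ereal \<delta>t"
    by (intro min_absorb1) (auto simp: less_imp_le)
  then show "horizon = \<delta>t"
    by (simp add: horizon_def end_time_def)
  show "{0..\<delta>t} \<subseteq> times"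
  proof
    fix t assume "t \<in> {0..\<delta>t}"
    then show "t \<in> times"
      using le_less_trans[OF _ less, of "ereal t"] by (simp add: times_def)
  qed
qed

theorem closed_loop_solution:
  obtains x v where
    "unique_solution_on D rhs {} {0..<horizon} x0 x"
    "admissible_input vmax v"
    "unique_solution_on D (open_loop nb f v) (discontinuities v) {0..} x0 x"
    "(x \<longlongrightarrow> x horizon) (at_left horizon)" "x horizon \<in> configs D"
    "(\<forall>i. P3 S W \<delta>t (pr nb i l) (T i)) \<longrightarrow> unique_solution_on D rhs {} {0..\<delta>t} x0 x"
proof -
  \<comment> \<open>A global solution is continuous at \<open>\<sigma>\<close> and stays in
    \<open>configs D\<close>; this is the source of all limits of closed-loop solutions.\<close>
  have limit: "(\<xi> \<longlongrightarrow> \<xi> \<sigma>) (at_left \<sigma>) \<and> \<xi> \<sigma> \<in> configs D"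
    if "unique_solution_on D F E {0..} x0 \<xi>" "0 < \<sigma>" for F E \<xi> \<sigma>
  proof -
    have \<xi>: "solution_on D F E {0..} \<xi>"
      using that by (simp add: unique_solution_on_def)
    then have "continuous_on {0..\<sigma>} \<xi>"
      by (auto simp: solution_on_def intro: continuous_on_subset)
    then show ?thesis
      using continuous_on_Icc_at_leftD[of 0 \<sigma> \<xi>] \<xi> that(2) by (auto simp: solution_on_def)
  qed
  obtain x where x: "solution_on D rhs {} {0..<horizon} x" "x 0 = x0"
  proof (rule solution_exists_until[OF rhs_locally_lipschitz D horizon(3) x0(1)])
    fix \<sigma> x
    assume \<sigma>: "0 < \<sigma>" "\<sigma> < horizon" and x: "solution_on D rhs {} {0..<\<sigma>} x" "x 0 = x0"
    have "\<sigma> \<le> \<delta>t" "{0..<\<sigma>} \<subseteq> times"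
      using \<sigma>(2) horizon(2,3) by (auto simp: subset_iff)
    then obtain v \<xi> where
      \<xi>: "unique_solution_on D (open_loop nb f v) (discontinuities v) {0..} x0 \<xi>"
      and eq: "\<And>t. t \<in> {0..<\<sigma>} \<Longrightarrow> x t = \<xi> t"
      using coincides_with_open_loop[OF x \<sigma>(1)] by blast
    have "\<forall>\<^sub>F t in at_left \<sigma>. \<xi> t = x t"
      using eq \<sigma>(1) unfolding eventually_at_left[OF \<sigma>(1)] by (intro exI[of _ 0]) auto
    then have "(x \<longlongrightarrow> \<xi> \<sigma>) (at_left \<sigma>)"
      using limit[OF \<xi> \<sigma>(1)] Lim_transform_eventually by blast
    then show "\<exists>z\<in>configs D. (x \<longlongrightarrow> z) (at_left \<sigma>)"
      using limit[OF \<xi> \<sigma>(1)] by blast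
  qed
  obtain v \<xi> where v: "admissible_input vmax v"
    and \<xi>: "unique_solution_on D (open_loop nb f v) (discontinuities v) {0..} x0 \<xi>"
    and eq: "\<And>t. t \<in> {0..<horizon} \<Longrightarrow> x t = \<xi> t"
    using coincides_with_open_loop[OF x horizon(1,2,3)] by blast
  have \<xi>_0: "\<xi> 0 = x0"
    using \<xi> by (simp add: unique_solution_on_def)
  \<comment> \<open>From here on \<open>\<xi>\<close> replaces \<open>x\<close>, about whose value
    at the end time nothing is known.\<close>
  have \<xi>_sol: "solution_on D rhs {} {0..<horizon} \<xi>"
    by (rule solution_on_cong[OF x(1)]) (simp add: eq)
  have "unique_solution_on D rhs {} {0..\<delta>t} x0 \<xi>"
    if P3: "\<forall>i. P3 S W \<delta>t (pr nb i l) (T i)"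
  proof (rule unique_solution_on_rhs)
    note P3' = horizon_P3[OF P3[rule_format]]
    have "solution_on D (open_loop nb f v) (discontinuities v) {0..} \<xi>"
      using \<xi> by (simp add: unique_solution_on_def)
    then have \<xi>': "continuous_on {0..\<delta>t} \<xi>" "\<And>t. t \<in> {0..\<delta>t} \<Longrightarrow> \<xi> t \<in> configs D"
      by (auto simp: solution_on_def intro: continuous_on_subset)
    \<comment> \<open>At \<open>\<delta>t\<close> the open-loop equation says nothing about the
      feedback; the closed-loop equation there is recovered from the left by continuity of
      \<open>rhs\<close> along \<open>\<xi>\<close>.\<close>
    show "solution_on D rhs {} {0..\<delta>t} \<xi>"
    proof (rule solution_on_removable[OF rhs_locally_lipschitz P3'(2) finite.emptyI \<xi>'])
      fix t assume t: "t \<in> {0<..<\<delta>t} - {}"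
      have "(\<xi> has_vector_derivative rhs t (\<xi> t)) (at t within {0..<\<delta>t})"
        using \<xi>_sol t by (simp add: solution_on_def P3'(1))
      moreover have "at t within {0..<\<delta>t} = at t"
        using t by (intro at_within_interior) simp
      ultimately show "(\<xi> has_vector_derivative rhs t (\<xi> t)) (at t)"
        by simp
    qed
    show "{0..\<delta>t} \<subseteq> times"
      by (rule P3'(2))
  qed (rule \<xi>_0)
  then have "(\<forall>i. P3 S W \<delta>t (pr nb i l) (T i)) \<longrightarrow> unique_solution_on D rhs {} {0..\<delta>t} x0 \<xi>"
    by blast
  with limit[OF \<xi> horizon(1)] show thesis
    by (intro that[OF unique_solution_on_rhs[OF \<xi>_sol \<xi>_0 horizon(3)] v \<xi>]) simp_all
qed

end
theorem proposition4p9: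
  fixes D :: "(real ^ 'n::finite) set"
    and nb :: "'a::finite \<Rightarrow> 'a list"
    and f :: "'a \<Rightarrow> (real ^ 'n) list \<Rightarrow> real ^ 'n"
    and M vmax \<delta>t :: real
    and I :: "'c set"
    and S :: "'c \<Rightarrow> (real ^ 'n) set"
    and W :: "(real ^ 'n) set"
    and l :: "'a \<Rightarrow> 'c"
    and T :: "'a \<Rightarrow> 'n horizon"
    and k :: "'a \<Rightarrow> 'n law"
  assumes D: "D \<noteq> {}" "open D" "connected D"
    and nb: "\<And>i. distinct (nb i)" "\<And>i. i \<notin> set (nb i)"
    and f_lipschitz: "\<And>i. locally_lipschitz_wrt tuple_dist (tuples D (length (nb i) + 1)) (f i)"
    and f_bound: "\<And>i X. X \<in> tuples D (length (nb i) + 1) \<Longrightarrow> norm (f i X) \<le> M"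
    and vmax: "0 < vmax" "vmax < M"
    and invariance: "invariance_assumption D nb f vmax"
    and cells: "cell_decomposition D I S"
    and \<delta>t: "0 < \<delta>t"
    and W: "W \<noteq> {}"
    and l: "\<And>i. l i \<in> I"
    and T_pos: "\<And>i. feedback_horizon S W (pr nb i l) (T i)"
    and P1: "\<And>i. P1 D S W (pr nb i l) (T i) (k i)"
    and P2: "\<And>i. P2 D S W \<delta>t M vmax (pr nb i l) (T i) (k i)"
  shows "\<forall>w. (\<forall>i. w i \<in> W) \<longrightarrow> (\<forall>x0\<in>configs D. (\<forall>i. x0 $ i \<in> S (l i)) \<longrightarrow>
    (\<exists>x.
      unique_solution_on D (closed_loop nb f k x0 w) {} {0..<end_time \<delta>t T x0 w} x0 x \<and>
      (\<exists>z\<in>configs D. (x \<longlongrightarrow> z) (at_left (end_time \<delta>t T x0 w))) \<and>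
      ((\<forall>i. P3 S W \<delta>t (pr nb i l) (T i)) \<longrightarrow>
        unique_solution_on D (closed_loop nb f k x0 w) {} {0..\<delta>t} x0 x \<and>
        (\<forall>t\<in>{0..\<delta>t}. \<forall>i. norm (k i t (pr nb i (($) (x t))) (x0 $ i) (w i)) \<le> vmax) \<and>
        (\<exists>v \<xi>. admissible_input vmax v \<and>
          unique_solution_on D (open_loop nb f v) (discontinuities v) {0..} x0 \<xi> \<and>
          (\<forall>t\<in>{0..\<delta>t}. x t = \<xi> t)))))"
proof (intro allI impI ballI)
  fix w :: "'a \<Rightarrow> real ^ 'n" and x0 :: "real ^ 'n ^ 'a"
  assume w: "\<forall>i. w i \<in> W" and x0: "x0 \<in> configs D" "\<forall>i. x0 $ i \<in> S (l i)"
  interpret feedback_system D nb f M vmax \<delta>t S W l T k x0 w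
    by unfold_locales (rule D f_lipschitz f_bound vmax invariance \<delta>t T_pos P1 P2 x0(1)
        x0(2)[rule_format] w[rule_format] | assumption)+
  obtain x v where x: "unique_solution_on D rhs {} {0..<horizon} x0 x"
    and v: "admissible_input vmax v"
      "unique_solution_on D (open_loop nb f v) (discontinuities v) {0..} x0 x"
    and lim: "(x \<longlongrightarrow> x horizon) (at_left horizon)" "x horizon \<in> configs D"
    and P3: "(\<forall>i. P3 S W \<delta>t (pr nb i l) (T i)) \<longrightarrow>
      unique_solution_on D rhs {} {0..\<delta>t} x0 x"
    by (rule closed_loop_solution)
  have bound: "norm (k i t (pr nb i (($) (x t))) (x0 $ i) (w i)) \<le> vmax"
    if "\<forall>i. P3 S W \<delta>t (pr nb i l) (T i)" "t \<in> {0..\<delta>t}" for i t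
  proof -
    have "norm (input t (x t) $ i) \<le> vmax"
    proof (rule input_bound_along_solution)
      show "solution_on D rhs {} {0..\<delta>t} x" "x 0 = x0"
        using P3 that(1) by (simp_all add: unique_solution_on_def)
      show "{0..\<delta>t} \<subseteq> times"
        using horizon_P3(2) that(1) by simp
    qed (use that(2) in auto)
    then show ?thesis
      by (simp add: input_def)
  qed
  show "\<exists>x.
      unique_solution_on D rhs {} {0..<end_time \<delta>t T x0 w} x0 x \<and>
      (\<exists>z\<in>configs D. (x \<longlongrightarrow> z) (at_left (end_time \<delta>t T x0 w))) \<and>
      ((\<forall>i. P3 S W \<delta>t (pr nb i l) (T i)) \<longrightarrow>
        unique_solution_on D rhs {} {0..\<delta>t} x0 x \<and>
        (\<forall>t\<in>{0..\<delta>t}. \<forall>i. norm (k i t (pr nb i (($) (x t))) (x0 $ i) (w i)) \<le> vmax) \<and>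
        (\<exists>v \<xi>. admissible_input vmax v \<and>
          unique_solution_on D (open_loop nb f v) (discontinuities v) {0..} x0 \<xi> \<and>
          (\<forall>t\<in>{0..\<delta>t}. x t = \<xi> t)))"
    unfolding horizon_def[symmetric]
  proof (rule exI[of _ x], intro conjI impI)
    assume all: "\<forall>i. P3 S W \<delta>t (pr nb i l) (T i)"
    show "unique_solution_on D rhs {} {0..\<delta>t} x0 x"
      using P3 all by simp
    show "\<forall>t\<in>{0..\<delta>t}. \<forall>i. norm (k i t (pr nb i (($) (x t))) (x0 $ i) (w i)) \<le> vmax"
      using bound[OF all] by simp
    show "\<exists>v \<xi>. admissible_input vmax v \<and>
          unique_solution_on D (open_loop nb f v) (discontinuities v) {0..} x0 \<xi> \<and>
          (\<forall>t\<in>{0..\<delta>t}. x t = \<xi> t)"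
      \<comment> \<open>The witness \<open>x\<close> is itself the open-loop solution for
        \<open>v\<close>.\<close>
      using v by (intro exI[of _ v] exI[of _ x]) simp
  qed (use x lim in auto)
qed

end
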